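(* Let $\Phi=(A;\{E_i\}_{i=0}^d;A^*;\{E^*_i\}_{i=0}^d)$ be a Leonard system in $\mathcal{A}$ with parameter array $(\{\theta_i\}_{i=0}^d;\{\theta^*_i\}_{i=0}^d;\{\varphi_i\}_{i=1}^d;\{\phi_i\}_{i=1}^d)$, and let $\xi_0\in E_0V$, $\xi_d\in E_dV$, $\xi^*_0\in E^*_0V$, $\xi^*_d\in E^*_dV$ be nonzero vectors. Then (i) and (ii) hold. (i) Let $\{X_i\}_{i=0}^d$ denote one of the sequences $\{E_i\}_{i=0}^d$, $\{E_{d-i}\}_{i=0}^d$, $\{\tau_i(A)\}_{i=0}^d$, $\{\tau_{d-i}(A)\}_{i=0}^d$, $\{\eta_i(A)\}_{i=0}^d$, $\{\eta_{d-i}(A)\}_{i=0}^d$. Then for $0\le i\le d$, \begin{align*} \frac{\eta^*_d(\theta^*_0)}{\phi}\frac{\langle\xi_0,\xi^*_0\rangle}{\langle\xi_0,\xi^*_d\rangle}\sum_{r=0}^dX_rE^*_0\eta_{d-r}(A)\cdot\tau_i(A)\xi^*_d &= X_i\xi^*_0,\\ \frac{1}{\mathrm{tr}(E_0E^*_d)}\sum_{r=0}^d\frac{X_rE^*_dE_0\eta^*_r(A^* )}{\phi_d\phi_{d-1}\cdots\phi_{d-r+1}}\cdot\tau_i(A)\xi^*_d &= X_i\xi^*_d,\\ \frac{\eta^*_d(\theta^*_0)}{\phi}\frac{\langle\xi_0,\xi^*_0\rangle}{\langle\xi_0,\xi^*_d\rangle}\sum_{r=0}^dX_{d-r}E^*_0\eta_{d-r}(A)\cdot\tau_{d-i}(A)\xi^*_d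 &= X_i\xi^*_0,\\ \frac{1}{\mathrm{tr}(E_0E^*_d)}\sum_{r=0}^d\frac{X_{d-r}E^*_dE_0\eta^*_r(A^* )}{\phi_d\phi_{d-1}\cdots\phi_{d-r+1}}\cdot\tau_{d-i}(A)\xi^*_d &= X_i\xi^*_d. \end{align*} (ii) Let $\{X_i\}_{i=0}^d$ denote one of the sequences $\{E^*_i\}_{i=0}^d$, $\{E^*_{d-i}\}_{i=0}^d$, $\{\tau^*_i(A^* )\}_{i=0}^d$, $\{\tau^*_{d-i}(A^* )\}_{i=0}^d$, $\{\eta^*_i(A^* )\}_{i=0}^d$, $\{\eta^*_{d-i}(A^* )\}_{i=0}^d$. Then for $0\le i\le d$, \begin{align*} \frac{\langle\xi_0,\xi_0\rangle}{\langle\xi_0,\xi^*_d\rangle}\sum_{r=0}^d\frac{X_rE_0\eta^*_r(A^* )}{\phi_d\phi_{d-1}\cdots\phi_{d-r+1}}\cdot\tau_i(A)\xi^*_d &= X_i\xi_0,\\ \frac{\eta^*_d(\theta^*_0)}{\varphi}\frac{\langle\xi_d,\xi_d\rangle}{\langle\xi_d,\xi^*_d\rangle}\sum_{r=0}^dX_rE_dE^*_0\eta_{d-r}(A)\cdot\tau_i(A)\xi^*_d &= X_i\xi_d,\\ \frac{\langle\xi_0,\xi_0\rangle}{\langle\xi_0,\xi^*_d\rangle}\sum_{r=0}^d\frac{X_{d-r}E_0\eta^*_r(A^* )}{\phi_d\phi_{d-1}\cdots\phi_{d-r+1}}\cdot\tau_{d-i}(A)\xi^*_d &= X_i\xi_0,\\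 \frac{\eta^*_d(\theta^*_0)}{\varphi}\frac{\langle\xi_d,\xi_d\rangle}{\langle\xi_d,\xi^*_d\rangle}\sum_{r=0}^dX_{d-r}E_dE^*_0\eta_{d-r}(A)\cdot\tau_{d-i}(A)\xi^*_d &= X_i\xi_d. \end{align*}
   Context: Let $\mathbb{K}$ be a field, $d\ge 0$ an integer, $\mathcal{A}$ a $\mathbb{K}$-algebra isomorphic to the algebra $\mathrm{Mat}_{d+1}(\mathbb{K})$ of all $(d+1)\times(d+1)$ matrices over $\mathbb{K}$, $I$ its identity, and $V$ an irreducible left $\mathcal{A}$-module (so $\dim V=d+1$). For $X\in\mathcal{A}$, $\mathrm{tr}(X)$ is the trace of $X$ (equivalently of its action on $V$). Leonard system. An element of $\mathcal{A}$ is multiplicity-free if it has $d+1$ mutually distinct eigenvalues in $\mathbb{K}$. If $A$ is multiplicity-free with eigenvalues $\theta_0,\dots,\theta_d$, the primitive idempotent of $A$ associated with $\theta_i$ is $E_i=\prod_{0\le j\le d,\,j\ne i}\frac{A-\theta_jI}{\theta_i-\theta_j}$ (the projection onto the one-dimensional $\theta_i$-eigenspace $E_iV$). A Leonard system in $\mathcal{A}$ is a sequence $\Phi=(A;\{E_i\}_{i=0}^d;A^*;\{E^*_i\}_{i=0}^d)$ such that: (i) each of $A,A^*$ is a multiplicity-free element of $\mathcal{A}$ ($A^*$ is just another element; no adjoint is meant); (ii) $\{E_i\}_{i=0}^d$ is an ordering of the primitive idempotents of $A$; (iii) $\{E^*_i\}_{i=0}^d$ is an ordering of the primitive idempotents of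 $A^*$; (iv) for $0\le i,j\le d$, $E_iA^*E_j=0$ if $|i-j|>1$ and $E_iA^*E_j\ne0$ if $|i-j|=1$; (v) for $0\le i,j\le d$, $E^*_iAE^*_j=0$ if $|i-j|>1$ and $E^*_iAE^*_j\neq0$ if $|i-j|=1$. Parameter array. $\theta_i$ (resp. $\theta^*_i$) is the eigenvalue of $A$ (resp. $A^*$) associated with $E_i$ (resp. $E^*_i$). For $0\le i\le d$ define polynomials $\tau_i=(\lambda-\theta_0)(\lambda-\theta_1)\cdots(\lambda-\theta_{i-1})$, $\eta_i=(\lambda-\theta_d)(\lambda-\theta_{d-1})\cdots(\lambda-\theta_{d-i+1})$, $\tau^*_i=(\lambda-\theta^*_0)(\lambda-\theta^*_1)\cdots(\lambda-\theta^*_{i-1})$, $\eta^*_i=(\lambda-\theta^*_d)(\lambda-\theta^*_{d-1})\cdots(\lambda-\theta^*_{d-i+1})$. For $1\le i\le d$ define $\varphi_i=(\theta^*_0-\theta^*_i)\frac{\mathrm{tr}(\tau_i(A)E^*_0)}{\mathrm{tr}(\tau_{i-1}(A)E^*_0)}$ and $\phi_i=(\theta^*_0-\theta^*_i)\frac{\mathrm{tr}(\eta_i(A)E^*_0)}{\mathrm{tr}(\eta_{i-1}(A)E^*_0)}$; the denominators, and all $\varphi_i,\phi_i$, are known to be nonzero. The parameter array of $\Phi$ is $(\{\theta_i\}_{i=0}^d;\{\theta^*_i\}_{i=0}^d;\{\varphi_i\}_{i=1}^d;\{\phi_i\}_{i=1}^d)$. Abbreviate $\varphi=\varphi_1\varphi_2\cdots\varphi_d$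 and $\phi=\phi_1\phi_2\cdots\phi_d$. Empty products are $1$. Bilinear form. There is a unique antiautomorphism $\dagger$ of $\mathcal{A}$ ($\mathbb{K}$-linear bijection with $(XY)^\dagger=Y^\dagger X^\dagger$) with $A^\dagger=A$ and $A^{*\dagger}=A^*$. $\langle\,,\rangle$ denotes a fixed nonzero bilinear form on $V$ with $\langle Xu,v\rangle=\langle u,X^\dagger v\rangle$ for all $X\in\mathcal{A}$, $u,v\in V$; it exists, is unique up to a nonzero scalar factor, and is nondegenerate and symmetric. All scalars appearing in denominators (traces and inner products) are known to be nonzero. The notation $T\cdot v$ means the element $T\in\mathcal{A}$ (including the scalar prefactor and the whole sum) applied to $v\in V$. *)

theory Defs
  imports "Jordan_Normal_Form.Char_Poly" "HOL-Computational_Algebra.Polynomial"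
begin

(* The type 'a together with the scalar multiplication scaleA is a unital associative
   'k-algebra; rep is an isomorphism onto the (d+1) x (d+1) matrices. Eigenvalues and traces of
   elements of 'a are read off through rep; they do not depend on which isomorphism is chosen. *)
locale matrix_algebra = vector_space scaleA
  for scaleA :: "'k::field \<Rightarrow> 'a::ring_1 \<Rightarrow> 'a" +
  fixes d :: nat and rep :: "'a \<Rightarrow> 'k mat"
  assumes scaleA_mult_left: "scaleA c (x * y) = scaleA c x * y"
    and scaleA_mult_right: "scaleA c (x * y) = x * scaleA c y"
    and rep_bij: "bij_betw rep UNIV (carrier_mat (d + 1) (d + 1))"
    and rep_add: "rep (x + y) = rep x + rep y"
    and rep_scale: "rep (scaleA c x) = c \<cdot>\<^sub>m rep x"
    and rep_mult: "rep (x * y) = rep x * rep y"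
    and rep_one: "rep 1 = 1\<^sub>m (d + 1)"

locale irreducible_module =
  matrix_algebra scaleA d rep + V: vector_space scaleV
  for scaleA :: "'k::field \<Rightarrow> 'a::ring_1 \<Rightarrow> 'a" and d :: nat and rep :: "'a \<Rightarrow> 'k mat"
    and scaleV :: "'k \<Rightarrow> 'v::ab_group_add \<Rightarrow> 'v" +
  fixes act :: "'a \<Rightarrow> 'v \<Rightarrow> 'v"
  assumes act_linear_left: "Vector_Spaces.linear scaleA scaleV (\<lambda>x. act x v)"
    and act_linear_right: "Vector_Spaces.linear scaleV scaleV (act x)"
    and act_mult: "act (x * y) v = act x (act y v)"
    and act_one: "act 1 v = v"
    and nonzero: "\<exists>v::'v. v \<noteq> 0"
    and irreducible: "\<lbrakk>V.subspace W; \<And>x w. w \<in> W \<Longrightarrow> act x w \<in> W\<rbrakk> \<Longrightarrow> W = {0} \<or> W = UNIV"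

definition alg_trace :: "('a \<Rightarrow> 'k::field mat) \<Rightarrow> 'a \<Rightarrow> 'k" where
  "alg_trace rep x = (\<Sum>i<dim_row (rep x). rep x $$ (i, i))"

definition alg_poly :: "('k::field \<Rightarrow> 'a::ring_1 \<Rightarrow> 'a) \<Rightarrow> 'k poly \<Rightarrow> 'a \<Rightarrow> 'a" where
  "alg_poly scaleA p x = (\<Sum>i\<le>degree p. scaleA (coeff p i) (x ^ i))"

definition multiplicity_free :: "nat \<Rightarrow> ('a \<Rightarrow> 'k::field mat) \<Rightarrow> 'a \<Rightarrow> bool" where
  "multiplicity_free d rep x \<longleftrightarrow> card {t. eigenvalue (rep x) t} = d + 1"

(* The product is taken over a list because the algebra is noncommutative; its factors commute. *)
definition primitive_idempotent ::
  "('k::field \<Rightarrow> 'a::ring_1 \<Rightarrow> 'a) \<Rightarrow> nat \<Rightarrow> 'a \<Rightarrow> (nat \<Rightarrow> 'k) \<Rightarrow> nat \<Rightarrow> 'a" where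
  "primitive_idempotent scaleA d x \<theta> i =
     (\<Prod>j\<leftarrow>filter (\<lambda>j. j \<noteq> i) [0..<d + 1].
        scaleA (1 / (\<theta> i - \<theta> j)) (x - scaleA (\<theta> j) 1))"

(* E 0, ..., E d is an ordering of the primitive idempotents of x, and \<theta> i is the eigenvalue
   of x associated with E i. Values at indices above d are irrelevant here and below. *)
definition idempotents_with_eigenvalues ::
  "('k::field \<Rightarrow> 'a::ring_1 \<Rightarrow> 'a) \<Rightarrow> nat \<Rightarrow> ('a \<Rightarrow> 'k mat) \<Rightarrow> 'a \<Rightarrow> (nat \<Rightarrow> 'a) \<Rightarrow> (nat \<Rightarrow> 'k) \<Rightarrow> bool"
where
  "idempotents_with_eigenvalues scaleA d rep x E \<theta> \<longleftrightarrow>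
     bij_betw \<theta> {..d} {t. eigenvalue (rep x) t} \<and>
     (\<forall>i\<le>d. E i = primitive_idempotent scaleA d x \<theta> i)"

definition leonard_system ::
  "('k::field \<Rightarrow> 'a::ring_1 \<Rightarrow> 'a) \<Rightarrow> nat \<Rightarrow> ('a \<Rightarrow> 'k mat) \<Rightarrow>
   'a \<Rightarrow> (nat \<Rightarrow> 'a) \<Rightarrow> 'a \<Rightarrow> (nat \<Rightarrow> 'a) \<Rightarrow> bool"
where
  "leonard_system scaleA d rep A E As Es \<longleftrightarrow>
     multiplicity_free d rep A \<and> multiplicity_free d rep As \<and>
     (\<exists>\<theta>. idempotents_with_eigenvalues scaleA d rep A E \<theta>) \<and>
     (\<exists>\<theta>s. idempotents_with_eigenvalues scaleA d rep As Es \<theta>s) \<and>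
     (\<forall>i\<le>d. \<forall>j\<le>d.
        (\<bar>int i - int j\<bar> > 1 \<longrightarrow> E i * As * E j = 0) \<and>
        (\<bar>int i - int j\<bar> = 1 \<longrightarrow> E i * As * E j \<noteq> 0)) \<and>
     (\<forall>i\<le>d. \<forall>j\<le>d.
        (\<bar>int i - int j\<bar> > 1 \<longrightarrow> Es i * A * Es j = 0) \<and>
        (\<bar>int i - int j\<bar> = 1 \<longrightarrow> Es i * A * Es j \<noteq> 0))"

definition tau :: "(nat \<Rightarrow> 'k::field) \<Rightarrow> nat \<Rightarrow> 'k poly" where
  "tau \<theta> i = (\<Prod>j<i. [:- \<theta> j, 1:])"

definition eta :: "nat \<Rightarrow> (nat \<Rightarrow> 'k::field) \<Rightarrow> nat \<Rightarrow> 'k poly" where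
  "eta d \<theta> i = (\<Prod>j<i. [:- \<theta> (d - j), 1:])"

definition parameter_array ::
  "('k::field \<Rightarrow> 'a::ring_1 \<Rightarrow> 'a) \<Rightarrow> nat \<Rightarrow> ('a \<Rightarrow> 'k mat) \<Rightarrow>
   'a \<Rightarrow> (nat \<Rightarrow> 'a) \<Rightarrow> 'a \<Rightarrow> (nat \<Rightarrow> 'a) \<Rightarrow>
   (nat \<Rightarrow> 'k) \<Rightarrow> (nat \<Rightarrow> 'k) \<Rightarrow> (nat \<Rightarrow> 'k) \<Rightarrow> (nat \<Rightarrow> 'k) \<Rightarrow> bool"
where
  "parameter_array scaleA d rep A E As Es \<theta> \<theta>s varphi phi \<longleftrightarrow>
     idempotents_with_eigenvalues scaleA d rep A E \<theta> \<and>
     idempotents_with_eigenvalues scaleA d rep As Es \<theta>s \<and>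
     (\<forall>i\<in>{1..d}. varphi i = (\<theta>s 0 - \<theta>s i) *
        (alg_trace rep (alg_poly scaleA (tau \<theta> i) A * Es 0) /
         alg_trace rep (alg_poly scaleA (tau \<theta> (i - 1)) A * Es 0))) \<and>
     (\<forall>i\<in>{1..d}. phi i = (\<theta>s 0 - \<theta>s i) *
        (alg_trace rep (alg_poly scaleA (eta d \<theta> i) A * Es 0) /
         alg_trace rep (alg_poly scaleA (eta d \<theta> (i - 1)) A * Es 0)))"

definition antiautomorphism :: "('k::field \<Rightarrow> 'a::ring_1 \<Rightarrow> 'a) \<Rightarrow> ('a \<Rightarrow> 'a) \<Rightarrow> bool" where
  "antiautomorphism scaleA dag \<longleftrightarrow>
     Vector_Spaces.linear scaleA scaleA dag \<and> bij dag \<and> (\<forall>x y. dag (x * y) = dag y * dag x)"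

definition bilinear_form :: "('k::field \<Rightarrow> 'v::ab_group_add \<Rightarrow> 'v) \<Rightarrow> ('v \<Rightarrow> 'v \<Rightarrow> 'k) \<Rightarrow> bool" where
  "bilinear_form scaleV B \<longleftrightarrow>
     (\<forall>v. Vector_Spaces.linear scaleV (*) (\<lambda>u. B u v)) \<and>
     (\<forall>u. Vector_Spaces.linear scaleV (*) (B u))"

end

theory Submission
  imports Defs
begin

text \<open>
Write \<open>u\<^sub>i = \<eta>\<^sub>i(A) \<xi>\<^sup>*\<^sub>0\<close> and \<open>w\<^sub>i = \<tau>\<^sub>i(A) \<xi>\<^sup>*\<^sub>d\<close>. The sequence \<open>X\<close> enters the eight formulas only through
the factor \<open>X r\<close> on the left of each summand. They hold for every sequence \<open>X\<close>, because the remaining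
factors of the summand, with the scalar in front, send \<open>w\<^sub>i\<close> to the vector on the right if \<open>r = i\<close> and
to zero otherwise. Four such orthogonality relations are needed, one for each vector
on the right; the formulas with \<open>X (d - r)\<close> follow by reversal of the sequence.

All four rest on one computation (\<open>first_of_last_pairing\<close>): the vector
\<open>E\<^sup>*\<^sub>0 \<eta>\<^sub>d\<^sub>-\<^sub>r(A) w\<^sub>i\<close> vanishes unless \<open>r = i\<close>, and then it does not depend on \<open>i\<close>. Indeed, for \<open>r < i\<close>
the polynomial \<open>\<eta>\<^sub>d\<^sub>-\<^sub>r \<tau>\<^sub>i\<close> vanishes at all eigenvalues of \<open>A\<close>; for \<open>r > i\<close> its degree is smaller
than the \<open>d\<close> steps that the tridiagonal operator \<open>A\<close> needs from \<open>E\<^sup>*\<^sub>d V\<close> to \<open>E\<^sup>*\<^sub>0 V\<close>; and for \<open>r = i\<close>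
it is monic of degree \<open>d\<close>, so that only its leading term counts. Choosing the polynomial \<open>\<eta>\<^sub>d\<close>
or \<open>\<tau>\<^sub>d\<close>, which are multiples of \<open>E\<^sub>0\<close> and \<open>E\<^sub>d\<close>, the common value becomes
a passage from \<open>E\<^sup>*\<^sub>d V\<close> through \<open>E\<^sub>0 V\<close> or \<open>E\<^sub>d V\<close> to \<open>E\<^sup>*\<^sub>0 V\<close>.

The scalars come from the split decomposition. The vectors \<open>u\<^sub>i\<close> satisfy
\<open>(A\<^sup>* - \<theta>\<^sup>*\<^sub>i) u\<^sub>i = \<phi>\<^sub>i u\<^sub>i\<^sub>-\<^sub>1\<close> with the \<open>\<phi>\<^sub>i\<close> of the parameter array (\<open>split_recurrence\<close> and
\<open>split_coefficients\<close>). On the one hand the product of the \<open>\<phi>\<^sub>i\<close> telescopes to the trace of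
\<open>\<eta>\<^sub>d(A) E\<^sup>*\<^sub>0\<close>, up to the factor \<open>\<eta>\<^sup>*\<^sub>d(\<theta>\<^sup>*\<^sub>0)\<close>, and this trace is the scalar by which \<open>\<eta>\<^sub>d(A)\<close>
takes \<open>E\<^sup>*\<^sub>0 V\<close> through \<open>E\<^sub>0 V\<close> back to itself; in the same way the product of the \<open>varphi i\<close>, which
are formed with \<open>\<tau>\<^sub>i\<close>, belongs to the passage through \<open>E\<^sub>d V\<close>. Comparing the passages that start
in \<open>E\<^sup>*\<^sub>d V\<close> with those that start in \<open>E\<^sup>*\<^sub>0 V\<close> gives the ratios of inner products and settles
the formulas with \<open>E\<^sup>*\<^sub>0 \<eta>\<^sub>d\<^sub>-\<^sub>r(A)\<close> (\<open>transition_first_star\<close> and \<open>transition_last\<close>). On the other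
hand the recurrence gives \<open>\<eta>\<^sup>*\<^sub>r(A\<^sup>*) u\<^sub>d = \<phi>\<^sub>d \<dots> \<phi>\<^sub>d\<^sub>-\<^sub>r\<^sub>+\<^sub>1 u\<^sub>d\<^sub>-\<^sub>r\<close>. Since \<open>u\<^sub>d\<close> spans
\<open>E\<^sub>0 V\<close> and \<open>A\<close>, \<open>A\<^sup>*\<close> are self-adjoint for the bilinear form, the component of
\<open>\<eta>\<^sup>*\<^sub>r(A\<^sup>*) w\<^sub>i\<close> in \<open>E\<^sub>0 V\<close> is determined by \<open>\<langle>u\<^sub>d\<^sub>-\<^sub>r, w\<^sub>i\<rangle> = \<langle>\<xi>\<^sup>*\<^sub>0, \<eta>\<^sub>d\<^sub>-\<^sub>r(A) w\<^sub>i\<rangle>\<close>,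
which is the pairing above (\<open>transition_first\<close>).

The denominators are nonzero because a nonzero vector of \<open>E\<^sup>*\<^sub>0 V\<close> or \<open>E\<^sup>*\<^sub>d V\<close> has nonzero components
in \<open>E\<^sub>0 V\<close> and \<open>E\<^sub>d V\<close>, and conversely (\<open>end_component_nonzero\<close>).
\<close>

section \<open>Primitive idempotents as matrix units\<close>

context matrix_algebra
begin

lemma rep_carrier: "rep x \<in> carrier_mat (d + 1) (d + 1)"
  using rep_bij by (auto simp: bij_betw_def)

lemma rep_carrier_Suc [simp]: "rep x \<in> carrier_mat (Suc d) (Suc d)"
  using rep_carrier[of x] by simp

lemma rep_dims [simp]: "dim_row (rep x) = d + 1" "dim_col (rep x) = d + 1"
  using carrier_matD[OF rep_carrier[of x]] by simp_all

lemma rep_inject: "rep x = rep y \<longleftrightarrow> x = y"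
  using rep_bij by (auto simp: bij_betw_def inj_on_def)

lemma rep_surj: "M \<in> carrier_mat (d + 1) (d + 1) \<Longrightarrow> \<exists>x. rep x = M"
  using rep_bij by (metis bij_betw_imp_surj_on imageE)

lemma rep_zero: "rep 0 = 0\<^sub>m (d + 1) (d + 1)"
  using rep_scale[of 0 0] by (intro eq_matI) (auto, metis index_smult_mat(1) mult_zero_left rep_dims Suc_eq_plus1)

lemma rep_diff: "rep (x - y) = rep x - rep y"
proof -
  have "rep x = rep (x - y) + rep y" using rep_add[of "x - y" y] by simp
  thus ?thesis by (intro eq_matI) auto
qed

lemma rep_sum_index:
  assumes "finite S" "i < d + 1" "j < d + 1"
  shows "rep (sum f S) $$ (i, j) = (\<Sum>x\<in>S. rep (f x) $$ (i, j))"
  using assms(1) by (induction S rule: finite_induct) (use assms in \<open>auto simp: rep_zero rep_add\<close>)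

lemma rep_mult_index:
  assumes "i < d + 1" "j < d + 1"
  shows "rep (x * y) $$ (i, j) = (\<Sum>k<d + 1. rep x $$ (i, k) * rep y $$ (k, j))"
  using assms by (auto simp: rep_mult scalar_prod_def lessThan_atLeast0 intro!: sum.cong)

text \<open>A primitive idempotent is a product of linear factors in its generator, so its effect on each
eigenvector is a scalar that can be read off from the factors.\<close>

lemma rep_linear_factors_eigenvector:
  assumes v: "v \<in> carrier_vec (d + 1)" and ev: "rep x *\<^sub>v v = \<mu> \<cdot>\<^sub>v v"
  shows "rep (\<Prod>j\<leftarrow>js. scaleA (c j) (x - scaleA (t j) 1)) *\<^sub>v v
    = (\<Prod>j\<leftarrow>js. c j * (\<mu> - t j)) \<cdot>\<^sub>v v"
proof (induction js)
  case Nil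
  show ?case using v by (simp add: rep_one)
next
  case (Cons j js)
  define y where "y = (\<Prod>j\<leftarrow>js. scaleA (c j) (x - scaleA (t j) 1))"
  define q where "q = (\<Prod>j\<leftarrow>js. c j * (\<mu> - t j))"
  have smult_mat_vec: "(k \<cdot>\<^sub>m M) *\<^sub>v v = k \<cdot>\<^sub>v (M *\<^sub>v v)"
    if "M \<in> carrier_mat (d + 1) (d + 1)" for k and M :: "'k mat"
    using v that by (intro eq_vecI) auto
  have f: "rep (scaleA (c j) (x - scaleA (t j) 1)) *\<^sub>v v = (c j * (\<mu> - t j)) \<cdot>\<^sub>v v"
  proof -
    have "(rep x - t j \<cdot>\<^sub>m 1\<^sub>m (d + 1)) *\<^sub>v v = rep x *\<^sub>v v - t j \<cdot>\<^sub>v v"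
      using v by (subst minus_mult_distrib_mat_vec[OF rep_carrier])
        (auto intro!: eq_vecI)
    hence "rep (scaleA (c j) (x - scaleA (t j) 1)) *\<^sub>v v
        = c j \<cdot>\<^sub>v (rep x *\<^sub>v v - t j \<cdot>\<^sub>v v)"
      unfolding rep_scale rep_diff rep_one
      by (subst smult_mat_vec) (simp_all add: minus_carrier_mat)
    thus ?thesis using v by (intro eq_vecI) (auto simp: ev algebra_simps)
  qed
  have IH: "rep y *\<^sub>v v = q \<cdot>\<^sub>v v" using Cons.IH by (simp add: y_def q_def)
  have "rep (scaleA (c j) (x - scaleA (t j) 1) * y) *\<^sub>v v
     = rep (scaleA (c j) (x - scaleA (t j) 1)) *\<^sub>v (q \<cdot>\<^sub>v v)"
    using v by (simp add: rep_mult IH assoc_mult_mat_vec[OF rep_carrier rep_carrier])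
  also have "\<dots> = q \<cdot>\<^sub>v ((c j * (\<mu> - t j)) \<cdot>\<^sub>v v)"
    using mult_mat_vec[OF rep_carrier v] f by metis
  finally show ?case by (simp add: y_def[symmetric] q_def[symmetric] smult_smult_assoc mult.commute)
qed

text \<open>A change of basis gives another isomorphism onto the matrices with the same traces, so the trace
identities below may be checked in a basis of eigenvectors.\<close>

lemma matrix_algebra_conj:
  assumes P: "P \<in> carrier_mat (d + 1) (d + 1)" and Q: "Q \<in> carrier_mat (d + 1) (d + 1)"
    and QP: "Q * P = 1\<^sub>m (d + 1)"
  shows "matrix_algebra scaleA d (\<lambda>x. Q * rep x * P)"
    and "alg_trace (\<lambda>x. Q * rep x * P) x = alg_trace rep x"
proof -
  have PQ: "P * Q = 1\<^sub>m (d + 1)" using mat_mult_left_right_inverse[OF Q P QP] .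
  have can: "P * (Q * M * P) * Q = M" if M: "M \<in> carrier_mat (d+1) (d+1)" for M
  proof -
    have "P * (Q * M * P) * Q = (P * Q) * M * (P * Q)"
      using P Q M by (simp add: assoc_mult_mat[of _ "d+1" "d+1" _ "d+1" _ "d+1"])
    thus ?thesis using M PQ by simp
  qed
  have can': "Q * (P * M * Q) * P = M" if M: "M \<in> carrier_mat (d+1) (d+1)" for M
  proof -
    have "Q * (P * M * Q) * P = (Q * P) * M * (Q * P)"
      using P Q M by (simp add: assoc_mult_mat[of _ "d+1" "d+1" _ "d+1" _ "d+1"])
    thus ?thesis using M QP by simp
  qed
  show "matrix_algebra scaleA d (\<lambda>x. Q * rep x * P)"
  proof (unfold_locales)
    show "scaleA c (x * y) = scaleA c x * y" for c x y by (rule scaleA_mult_left)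
    show "scaleA c (x * y) = x * scaleA c y" for c x y by (rule scaleA_mult_right)
    show "bij_betw (\<lambda>x. Q * rep x * P) UNIV (carrier_mat (d + 1) (d + 1))"
    proof (rule bij_betwI')
      show "(Q * rep x * P = Q * rep y * P) = (x = y)" for x y
        using can[OF rep_carrier, of x] can[OF rep_carrier, of y] rep_inject by metis
      show "Q * rep x * P \<in> carrier_mat (d + 1) (d + 1)" for x
        using P Q by (meson mult_carrier_mat rep_carrier)
      fix M :: "'k mat" assume M: "M \<in> carrier_mat (d + 1) (d + 1)"
      obtain x where "rep x = P * M * Q" using rep_surj P Q M by (meson mult_carrier_mat)
      thus "\<exists>x\<in>UNIV. M = Q * rep x * P" using can'[OF M] by (intro bexI[of _ x]) simp_all
    qed
    show "Q * rep (x + y) * P = Q * rep x * P + Q * rep y * P" for x y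
      using P Q by (simp add: rep_add mult_add_distrib_mat[OF Q rep_carrier rep_carrier]
         add_mult_distrib_mat[of _ "d+1" "d+1" _ P])
    show "Q * rep (scaleA c x) * P = c \<cdot>\<^sub>m (Q * rep x * P)" for c x
      using P Q by (simp add: rep_scale mult_smult_distrib[OF Q rep_carrier]
         mult_smult_assoc_mat[of _ "d+1" "d+1" P])
    show "Q * rep (x * y) * P = Q * rep x * P * (Q * rep y * P)" for x y
    proof -
      have "Q * rep x * P * (Q * rep y * P) = Q * rep x * (P * Q) * rep y * P"
        using P Q rep_carrier[of x] rep_carrier[of y]
        by (smt (verit) assoc_mult_mat mult_carrier_mat)
      also have "\<dots> = Q * rep (x * y) * P"
        using P Q by (simp add: PQ rep_mult right_mult_one_mat[of _ "d+1" "d+1"] 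
           assoc_mult_mat[of _ "d+1" "d+1" _ "d+1" _ "d+1"])
      finally show ?thesis by simp
    qed
    show "Q * rep 1 * P = 1\<^sub>m (d + 1)" using Q QP by (simp add: rep_one)
  qed
  define M where "M = Q * rep x"
  have M: "M \<in> carrier_mat (d+1) (d+1)" using Q unfolding M_def by (meson mult_carrier_mat rep_carrier)
  have "alg_trace (\<lambda>x. Q * rep x * P) x = (\<Sum>i<d+1. \<Sum>j<d+1. M $$ (i,j) * P $$ (j,i))"
    using P Q M unfolding alg_trace_def M_def[symmetric]
    by (auto simp: scalar_prod_def lessThan_atLeast0 intro!: sum.cong)
  also have "\<dots> = (\<Sum>j<d+1. \<Sum>i<d+1. P $$ (j,i) * M $$ (i,j))"
    by (subst sum.swap) (simp add: mult.commute)
  also have "\<dots> = (\<Sum>j<d+1. (P * M) $$ (j,j))"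
    using P M by (auto simp: scalar_prod_def lessThan_atLeast0 intro!: sum.cong)
  also have "P * M = rep x" unfolding M_def using P Q PQ
    by (simp add: assoc_mult_mat[OF P Q rep_carrier, symmetric] left_mult_one_mat[OF rep_carrier])
  finally show "alg_trace (\<lambda>x. Q * rep x * P) x = alg_trace rep x" by (simp add: alg_trace_def)
qed

text \<open>The generator has as many eigenvalues as the size of the matrices, so its eigenvectors form a
basis. In that basis the primitive idempotents are the diagonal matrix units, because each of
them fixes one eigenvector and kills the others.\<close>

lemma diagonalizing_representation:
  assumes "idempotents_with_eigenvalues scaleA d rep A E \<theta>"
  obtains rep' where "matrix_algebra scaleA d rep'" "alg_trace rep' = alg_trace rep"
    "rep' A = mat (d + 1) (d + 1) (\<lambda>(j, k). if j = k then \<theta> j else 0)"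
    "\<And>i. i \<le> d \<Longrightarrow> rep' (E i) = mat (d + 1) (d + 1) (\<lambda>(j, k). if j = i \<and> k = i then 1 else 0)"
proof -
  have bij: "bij_betw \<theta> {..d} {t. eigenvalue (rep A) t}"
    and E: "\<And>i. i \<le> d \<Longrightarrow> E i = primitive_idempotent scaleA d A \<theta> i"
    using assms by (auto simp: idempotents_with_eigenvalues_def)
  have inj: "inj_on \<theta> {..d}" using bij by (auto simp: bij_betw_def)
  have "\<exists>v. eigenvector (rep A) v (\<theta> i)" if "i \<le> d" for i
    using bij that by (auto simp: bij_betw_def eigenvalue_def)
  then obtain v where v: "\<And>i. i \<le> d \<Longrightarrow> eigenvector (rep A) (v i) (\<theta> i)" by metis
  have vc: "v i \<in> carrier_vec (d+1)" and vev: "rep A *\<^sub>v v i = \<theta> i \<cdot>\<^sub>v v i"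
    and vnz: "v i \<noteq> 0\<^sub>v (d+1)" if "i \<le> d" for i
    using v[OF that] by (auto simp: eigenvector_def)
  have Ev: "rep (E i) *\<^sub>v v j = (if i = j then 1 else 0) \<cdot>\<^sub>v v j" if ij: "i \<le> d" "j \<le> d" for i j
  proof -
    define js where "js = filter (\<lambda>k. k \<noteq> i) [0..<d+1]"
    have "(\<Prod>k\<leftarrow>js. 1 / (\<theta> i - \<theta> k) * (\<theta> j - \<theta> k)) = (if i = j then 1 else 0)"
    proof (cases "i = j")
      case True
      have "map (\<lambda>k. 1 / (\<theta> i - \<theta> k) * (\<theta> j - \<theta> k)) js = map (\<lambda>_. 1) js"
        using True inj ij by (auto simp: js_def inj_on_def)
      thus ?thesis using True by (simp only: map_replicate_const prod_list_replicate) simp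
    next
      case False
      hence "j \<in> set js" using ij by (auto simp: js_def)
      hence "0 \<in> set (map (\<lambda>k. 1 / (\<theta> i - \<theta> k) * (\<theta> j - \<theta> k)) js)" by force
      thus ?thesis using False by (simp only: prod_list_zero_iff if_False)
    qed
    thus ?thesis
      using rep_linear_factors_eigenvector[OF vc[OF ij(2)] vev[OF ij(2)],
        of "\<lambda>k. 1 / (\<theta> i - \<theta> k)" \<theta> js]
      by (simp add: E[OF ij(1)] primitive_idempotent_def js_def)
  qed
  have "\<exists>k<d+1. v i $ k \<noteq> 0" if "i \<le> d" for i
    using vnz[OF that] vc[OF that] by (auto simp: vec_eq_iff)
  then obtain k where k: "\<And>i. i \<le> d \<Longrightarrow> k i < d + 1" "\<And>i. i \<le> d \<Longrightarrow> v i $ k i \<noteq> 0" by metis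
  define P where "P = mat (d+1) (d+1) (\<lambda>(r, j). v j $ r)"
  \<comment> \<open>Row \<open>i\<close> of the inverse is a suitably scaled row of the matrix of \<open>E i\<close>, since \<open>E i\<close> kills
    every eigenvector but \<open>v i\<close>.\<close>
  define Q where "Q = mat (d+1) (d+1) (\<lambda>(i, j). rep (E i) $$ (k i, j) / v i $ k i)"
  have P: "P \<in> carrier_mat (d+1) (d+1)" and Q: "Q \<in> carrier_mat (d+1) (d+1)"
    by (auto simp: P_def Q_def)
  have colP: "col P j = v j" if "j \<le> d" for j
    using vc[OF that] that by (intro eq_vecI) (auto simp: P_def)
  have QP: "Q * P = 1\<^sub>m (d+1)"
  proof (rule eq_matI)
    fix i j assume "i < dim_row (1\<^sub>m (d+1) :: 'k mat)" "j < dim_col (1\<^sub>m (d+1) :: 'k mat)"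
    hence ij: "i \<le> d" "j \<le> d" by auto
    have "(Q * P) $$ (i,j) = (\<Sum>r<d+1. rep (E i) $$ (k i, r) * v j $ r) / v i $ k i"
      using ij by (auto simp: P_def Q_def scalar_prod_def lessThan_atLeast0 sum_divide_distrib simp del: sum.op_ivl_Suc intro!: sum.cong)
    also have "(\<Sum>r<d+1. rep (E i) $$ (k i, r) * v j $ r) = (rep (E i) *\<^sub>v v j) $ k i"
      using ij vc[OF ij(2)] k[OF ij(1)] by (auto simp: scalar_prod_def lessThan_atLeast0 intro!: sum.cong)
    also have "\<dots> = (if i = j then v i $ k i else 0)"
      using Ev[OF ij] vc[OF ij(2)] k[OF ij(1)] by auto
    finally show "(Q * P) $$ (i,j) = 1\<^sub>m (d+1) $$ (i,j)" using ij k[OF ij(1)] by auto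
  qed (auto simp: P_def Q_def)
  have diag: "Q * rep X * P = mat (d+1) (d+1) (\<lambda>(r, j). if r = j then f j else 0)"
    if X: "\<And>j. j \<le> d \<Longrightarrow> rep X *\<^sub>v v j = f j \<cdot>\<^sub>v v j" for X f
  proof -
    have XP: "rep X * P = P * mat (d+1) (d+1) (\<lambda>(r, j). if r = j then f j else 0)"
    proof (rule eq_matI)
      fix r j assume "r < dim_row (P * mat (d+1) (d+1) (\<lambda>(r, j). if r = j then f j else 0))"
        "j < dim_col (P * mat (d+1) (d+1) (\<lambda>(r, j). if r = j then f j else 0))"
      hence rj: "r \<le> d" "j \<le> d" using P by auto
      have "(rep X * P) $$ (r,j) = (rep X *\<^sub>v v j) $ r"
        using rj P colP[OF rj(2)] by (simp add: P_def)
      also have "\<dots> = P $$ (r,j) * f j" using X[OF rj(2)] rj vc[OF rj(2)] by (simp add: P_def)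
      also have "\<dots> = (P * mat (d+1) (d+1) (\<lambda>(r, j). if r = j then f j else 0)) $$ (r,j)"
        using rj P by (auto simp: scalar_prod_def sum.delta if_distrib cong: if_cong)
      finally show "(rep X * P) $$ (r,j) = (P * mat (d+1) (d+1) (\<lambda>(r, j). if r = j then f j else 0)) $$ (r,j)" .
    qed (use P in auto)
    show ?thesis using QP
      unfolding assoc_mult_mat[OF Q rep_carrier P] XP
      by (subst assoc_mult_mat[OF Q P, symmetric, of _ "d + 1"]) (auto simp: left_mult_one_mat[of _ "Suc d" "Suc d"])
  qed
  show thesis
  proof (rule that)
    show "matrix_algebra scaleA d (\<lambda>x. Q * rep x * P)" by (rule matrix_algebra_conj(1)[OF P Q QP])
    show "alg_trace (\<lambda>x. Q * rep x * P) = alg_trace rep"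
      by (rule ext) (rule matrix_algebra_conj(2)[OF P Q QP])
    show "Q * rep A * P = mat (d+1) (d+1) (\<lambda>(j, k). if j = k then \<theta> j else 0)"
      by (subst diag[of A \<theta>]) (auto simp: vev)
    show "Q * rep (E i) * P = mat (d+1) (d+1) (\<lambda>(j, k). if j = i \<and> k = i then 1 else 0)" if "i \<le> d" for i
      by (subst diag[of "E i" "\<lambda>j. if i = j then 1 else 0"]) (auto simp: Ev that)
  qed
qed

text \<open>All that is used later about primitive idempotents. In the diagonalizing basis every claim
compares entries of products with diagonal matrix units. The last two say that the idempotents
have rank one: \<open>E i * X * E i\<close> is a multiple of \<open>E i\<close>, whose factor is the diagonal entry of
\<open>X\<close>, and a nonzero \<open>E i * X * E j\<close> is a multiple of a matrix unit, which the opposite matrix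
unit takes back to \<open>E j\<close>.\<close>

lemma primitive_idempotent_identities:
  assumes "idempotents_with_eigenvalues scaleA d rep A E \<theta>" and "i \<le> d" and "j \<le> d"
  shows primitive_idempotent_mult: "E i * E j = (if i = j then E i else 0)"
    and primitive_idempotent_sum: "(\<Sum>k\<le>d. E k) = 1"
    and primitive_idempotent_eigen: "A * E i = scaleA (\<theta> i) (E i)"
    and primitive_idempotent_trace: "E i * X * E i = scaleA (alg_trace rep (X * E i)) (E i)"
    and primitive_idempotent_return: "E i * X * E j \<noteq> 0 \<Longrightarrow> \<exists>Y. E j * Y * (E i * X * E j) = E j"
proof -
  obtain rep' where R: "matrix_algebra scaleA d rep'" "alg_trace rep' = alg_trace rep"
    and RA: "rep' A = mat (d + 1) (d + 1) (\<lambda>(j, k). if j = k then \<theta> j else 0)"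
    and RE: "\<And>i. i \<le> d \<Longrightarrow> rep' (E i) = mat (d + 1) (d + 1) (\<lambda>(j, k). if j = i \<and> k = i then 1 else 0)"
    using diagonalizing_representation[OF assms(1)] by blast
  interpret R: matrix_algebra scaleA d rep' by (rule R)
  have eq: "x = y" if "\<And>r s. r < d + 1 \<Longrightarrow> s < d + 1 \<Longrightarrow> rep' x $$ (r, s) = rep' y $$ (r, s)" for x y
    using that R.rep_inject by (metis eq_matI R.rep_dims)
  have left: "rep' (E k * x) $$ (r, s) = (if r = k then rep' x $$ (r, s) else 0)"
    if "k \<le> d" "r < d + 1" "s < d + 1" for k x r s
    using that by (simp add: R.rep_mult_index RE if_distrib[of "\<lambda>z. z * _"] sum.delta cong: if_cong)
  have right: "rep' (x * E k) $$ (r, s) = (if s = k then rep' x $$ (r, s) else 0)"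
    if "k \<le> d" "r < d + 1" "s < d + 1" for k x r s
    using that by (simp add: R.rep_mult_index RE if_distrib[of "\<lambda>z. _ * z"] sum.delta cong: if_cong)
  have rE: "rep' (E k) $$ (r, s) = (if r = k \<and> s = k then 1 else 0)"
    if "k \<le> d" "r < d + 1" "s < d + 1" for k r s using that by (simp add: RE)
  show "E i * E j = (if i = j then E i else 0)"
    by (rule eq) (use assms in \<open>auto simp: left rE R.rep_zero\<close>)
  show "(\<Sum>k\<le>d. E k) = 1"
  proof (rule eq)
    fix r s assume rs: "r < d + 1" "s < d + 1"
    have "rep' (\<Sum>k\<le>d. E k) $$ (r, s) = (\<Sum>k\<le>d. if k = r then (if s = r then 1 else 0) else 0)"
      using rs by (simp only: R.rep_sum_index finite_atMost) (intro sum.cong, auto simp: rE)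
    also have "\<dots> = (if s = r then 1 else 0)" using rs by (subst sum.delta) auto
    finally show "rep' (\<Sum>k\<le>d. E k) $$ (r, s) = rep' 1 $$ (r, s)"
      using rs by (simp add: R.rep_one sum.delta)
  qed
  show "A * E i = scaleA (\<theta> i) (E i)"
    by (rule eq) (use assms in \<open>auto simp: right rE RA R.rep_scale\<close>)
  have tr: "alg_trace rep (X * E i) = rep' X $$ (i, i)"
    using assms(2) by (simp add: R(2)[symmetric] alg_trace_def right sum.delta)
  show "E i * X * E i = scaleA (alg_trace rep (X * E i)) (E i)"
    by (rule eq) (use assms in \<open>auto simp: left right rE tr R.rep_scale\<close>)
  assume nz: "E i * X * E j \<noteq> 0"
  define c where "c = rep' X $$ (i, j)"
  have "c \<noteq> 0"
  proof
    assume "c = 0"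
    hence "E i * X * E j = 0"
      by (intro eq) (use assms in \<open>auto simp: left right c_def R.rep_zero\<close>)
    thus False using nz by simp
  qed
  obtain Y where Y: "rep' Y = mat (d+1) (d+1) (\<lambda>(r,s). if r = j \<and> s = i then 1 / c else 0)"
    using R.rep_surj[of "mat (d+1) (d+1) (\<lambda>(r,s). if r = j \<and> s = i then 1 / c else 0)"] by auto
  have "E j * Y * (E i * X * E j) = E j"
  proof (rule eq)
    fix r s assume rs: "r < d + 1" "s < d + 1"
    have "rep' (E j * Y * (E i * X * E j)) $$ (r, s)
      = (\<Sum>k<d+1. rep' (E j * Y) $$ (r, k) * rep' (E i * X * E j) $$ (k, s))"
      using rs by (simp add: R.rep_mult_index)
    also have "\<dots> = (\<Sum>k<d+1. if k = i then (if r = j \<and> s = j then 1 else 0) else 0)"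
      using rs assms \<open>c \<noteq> 0\<close> by (intro sum.cong) (auto simp: left right Y c_def)
    also have "\<dots> = rep' (E j) $$ (r, s)" using rs assms by (simp add: rE sum.delta)
    finally show "rep' (E j * Y * (E i * X * E j)) $$ (r, s) = rep' (E j) $$ (r, s)" .
  qed
  thus "\<exists>Y. E j * Y * (E i * X * E j) = E j" by blast
qed

end

section \<open>Polynomials in an operator with simple spectrum\<close>

text \<open>Everything up to the final translation happens to operators on the module. This is the counterpart
of the evaluation of a polynomial at an algebra element.\<close>

definition op_poly ::
  "('k::field \<Rightarrow> 'v::ab_group_add \<Rightarrow> 'v) \<Rightarrow> 'k poly \<Rightarrow> ('v \<Rightarrow> 'v) \<Rightarrow> 'v \<Rightarrow> 'v" where
  "op_poly scale p f v = (\<Sum>i\<le>degree p. scale (coeff p i) ((f ^^ i) v))"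

lemma eta_eq_tau: "eta d \<theta> i = tau (\<lambda>j. \<theta> (d - j)) i"
  by (simp add: eta_def tau_def)

lemma tau_0: "tau \<theta> 0 = 1"
  by (simp add: tau_def)

lemma tau_Suc: "tau \<theta> (Suc i) = tau \<theta> i * [:- \<theta> i, 1:]"
  by (simp add: tau_def)

lemma poly_tau: "poly (tau \<theta> i) x = (\<Prod>j<i. x - \<theta> j)"
  by (simp add: tau_def poly_prod)

lemma tau_monic: "degree (tau \<theta> i) = i" "lead_coeff (tau \<theta> i) = 1"
proof -
  show m: "lead_coeff (tau \<theta> i) = 1" for i
    by (induction i) (simp_all add: tau_0 tau_Suc lead_coeff_mult del: mult_pCons_right)
  have "tau \<theta> i \<noteq> 0" for i using m[of i] by auto
  thus "degree (tau \<theta> i) = i"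
    by (induction i) (simp_all add: tau_0 tau_Suc degree_mult_eq del: mult_pCons_right)
qed

lemma tau_nonzero: "tau \<theta> i \<noteq> 0"
  using tau_monic(2)[of \<theta> i] by auto

text \<open>The operators \<open>e i\<close> are the projections onto the eigenlines of a diagonalizable \<open>a\<close>. That an
eigenspace is a line is expressed by the comparison of two of its vectors, so that no dimension
enters.\<close>

locale simple_spectrum = vector_space scale
  for scale :: "'k::field \<Rightarrow> 'v::ab_group_add \<Rightarrow> 'v" (infixr \<open>*s\<close> 75) +
  fixes d :: nat and a :: "'v \<Rightarrow> 'v" and e :: "nat \<Rightarrow> 'v \<Rightarrow> 'v" and \<theta> :: "nat \<Rightarrow> 'k"
  assumes linear_a: "Vector_Spaces.linear scale scale a"
    and linear_e: "Vector_Spaces.linear scale scale (e i)"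
    and e_e: "\<lbrakk>i \<le> d; j \<le> d\<rbrakk> \<Longrightarrow> e i (e j v) = (if i = j then e j v else 0)"
    and e_sum: "(\<Sum>i\<le>d. e i v) = v"
    and a_e: "i \<le> d \<Longrightarrow> a (e i v) = \<theta> i *s e i v"
    and inj_eigenvalues: "inj_on \<theta> {..d}"
    and e_line: "\<lbrakk>i \<le> d; e i v \<noteq> 0\<rbrakk> \<Longrightarrow> \<exists>c. e i w = c *s e i v"
begin

lemmas linear_add = module_hom.add[OF Vector_Spaces.linear.axioms(3)]
  and linear_scale = module_hom.scale[OF Vector_Spaces.linear.axioms(3)]
  and linear_zero = module_hom.zero[OF Vector_Spaces.linear.axioms(3)]
  and linear_diff = module_hom.diff[OF Vector_Spaces.linear.axioms(3)]
  and linear_sum = module_hom.sum[OF Vector_Spaces.linear.axioms(3)]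

lemmas a_simps = linear_add[OF linear_a] linear_scale[OF linear_a] linear_zero[OF linear_a]
    linear_diff[OF linear_a]
  and e_simps = linear_add[OF linear_e] linear_scale[OF linear_e] linear_zero[OF linear_e]
    linear_diff[OF linear_e]

text \<open>Identities between vectors are proved one eigenline at a time. On an eigenline a polynomial in
\<open>a\<close> is a scalar, and with this the usual rules for polynomials in an operator become rules for
values of polynomials.\<close>

lemma e_expand_cong: "(\<And>i. i \<le> d \<Longrightarrow> e i v = e i w) \<Longrightarrow> v = w"
  using e_sum[of v] e_sum[of w] by (metis (no_types, lifting) atMost_iff sum.cong)

lemma e_of_sum: "i \<le> d \<Longrightarrow> e i (\<Sum>j\<le>d. c j *s e j v) = c i *s e i v"
  by (simp add: linear_sum[OF linear_e] e_simps e_e if_distrib sum.delta cong: if_cong)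

lemma a_expand: "a v = (\<Sum>i\<le>d. \<theta> i *s e i v)"
proof -
  have "a v = a (\<Sum>i\<le>d. e i v)" by (simp add: e_sum)
  also have "\<dots> = (\<Sum>i\<le>d. a (e i v))" by (rule linear_sum[OF linear_a])
  finally show ?thesis by (simp add: a_e)
qed

lemma e_a: "i \<le> d \<Longrightarrow> e i (a v) = \<theta> i *s e i v"
  unfolding a_expand by (rule e_of_sum)

lemma e_funpow: "i \<le> d \<Longrightarrow> e i ((a ^^ k) v) = \<theta> i ^ k *s e i v"
  by (induction k) (simp_all add: e_a)

lemma e_op_poly: "i \<le> d \<Longrightarrow> e i (op_poly scale p a v) = poly p (\<theta> i) *s e i v"
  by (simp add: op_poly_def linear_sum[OF linear_e] e_simps e_funpow poly_altdef scale_sum_left)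

lemma op_poly_mult: "op_poly scale (p * q) a v = op_poly scale p a (op_poly scale q a v)"
  by (rule e_expand_cong) (simp add: e_op_poly)

lemma op_poly_linear_factor: "op_poly scale [:- t, 1:] a v = a v - t *s v"
  by (rule e_expand_cong) (simp add: e_op_poly e_simps e_a scale_left_diff_distrib)

lemma op_poly_1: "op_poly scale 1 a v = v"
  by (rule e_expand_cong) (simp add: e_op_poly)

lemma op_poly_expand: "op_poly scale p a v = (\<Sum>i\<le>d. poly p (\<theta> i) *s e i v)"
  by (rule e_expand_cong) (simp add: e_op_poly e_of_sum)

lemma op_poly_tau_Suc:
  "op_poly scale (tau t (Suc i)) a v = a (op_poly scale (tau t i) a v) - t i *s op_poly scale (tau t i) a v"
  by (simp only: tau_Suc mult.commute[of "tau t i"] op_poly_mult op_poly_linear_factor)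

text \<open>Every eigenvalue but the last is a root, so only one eigenline survives.\<close>

lemma op_poly_tau_d: "op_poly scale (tau \<theta> d) a v = (\<Prod>j<d. \<theta> d - \<theta> j) *s e d v"
proof (rule e_expand_cong)
  fix i assume "i \<le> d"
  moreover have "(\<Prod>j<d. \<theta> i - \<theta> j) = 0" if "i < d" using that by (auto intro: prod_zero)
  ultimately show "e i (op_poly scale (tau \<theta> d) a v) = e i ((\<Prod>j<d. \<theta> d - \<theta> j) *s e d v)"
    by (cases "i = d") (auto simp: e_op_poly poly_tau e_simps e_e)
qed

lemma tau_eigenvalue_nonzero: "(\<Prod>j<d. \<theta> d - \<theta> j) \<noteq> 0"
  using inj_onD[OF inj_eigenvalues, of d] by force

lemma e_on_line: "\<lbrakk>i \<le> d; \<xi> \<noteq> 0; e i \<xi> = \<xi>\<rbrakk> \<Longrightarrow> \<exists>c. e i w = c *s \<xi>"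
  using e_line[of i \<xi> w] by auto

lemma reverse_simple_spectrum: "simple_spectrum scale d a (\<lambda>i. e (d - i)) (\<lambda>i. \<theta> (d - i))"
proof (intro simple_spectrum.intro vector_space_axioms simple_spectrum_axioms.intro)
  show "(\<Sum>i\<le>d. e (d - i) v) = v" for v
    using e_sum[of v] sum.nat_diff_reindex[of "\<lambda>i. e i v" "Suc d"]
    by (simp add: lessThan_Suc_atMost)
  show "inj_on (\<lambda>i. \<theta> (d - i)) {..d}"
    using inj_onD[OF inj_eigenvalues] by (intro inj_onI) fastforce
  show "e (d - i) (e (d - j) v) = (if i = j then e (d - j) v else 0)" if "i \<le> d" "j \<le> d" for i j v
    using e_e[of "d - i" "d - j" v] that by auto
qed (simp_all add: linear_a linear_e a_e e_line)

end

section \<open>Tridiagonal pairs of operators and the split decomposition\<close>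

text \<open>The axioms are invariant under exchange of the two operators and under reversal of either ordering
of eigenlines. Each fact below is proved for one of the resulting configurations and transported
to the others. The axioms with distance one say that the off-diagonal entries of the tridiagonal
matrices, which are maps between lines, are injective.\<close>

locale tridiagonal_action = simple_spectrum scale d a e \<theta> + S: simple_spectrum scale d as es \<theta>s
  for scale :: "'k::field \<Rightarrow> 'v::ab_group_add \<Rightarrow> 'v" (infixr \<open>*s\<close> 75)
    and d a e \<theta> as es \<theta>s +
  assumes es_a_far: "\<lbrakk>i \<le> d; j \<le> d; 1 < \<bar>int i - int j\<bar>\<rbrakk> \<Longrightarrow> es i (a (es j v)) = 0"
    and es_a_near: "\<lbrakk>i \<le> d; j \<le> d; \<bar>int i - int j\<bar> = 1; es j v \<noteq> 0\<rbrakk> \<Longrightarrow> es i (a (es j v)) \<noteq> 0"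
    and e_as_far: "\<lbrakk>i \<le> d; j \<le> d; 1 < \<bar>int i - int j\<bar>\<rbrakk> \<Longrightarrow> e i (as (e j v)) = 0"
    and e_as_near: "\<lbrakk>i \<le> d; j \<le> d; \<bar>int i - int j\<bar> = 1; e j v \<noteq> 0\<rbrakk> \<Longrightarrow> e i (as (e j v)) \<noteq> 0"
begin

lemma swap: "tridiagonal_action scale d as es \<theta>s a e \<theta>"
  by (intro tridiagonal_action.intro tridiagonal_action_axioms.intro simple_spectrum_axioms
      S.simple_spectrum_axioms) (fact es_a_far es_a_near e_as_far e_as_near)+

lemma reverse: "tridiagonal_action scale d a (\<lambda>i. e (d - i)) (\<lambda>i. \<theta> (d - i)) as es \<theta>s"
proof -
  show ?thesis
  proof (intro tridiagonal_action.intro tridiagonal_action_axioms.intro reverse_simple_spectrum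
      S.simple_spectrum_axioms)
    fix i j :: nat and v
    assume ij: "i \<le> d" "j \<le> d"
    have eq: "\<bar>int (d - i) - int (d - j)\<bar> = \<bar>int i - int j\<bar>" using ij by linarith
    show "e (d - i) (as (e (d - j) v)) = 0" if "1 < \<bar>int i - int j\<bar>"
      by (rule e_as_far) (simp_all only: eq that diff_le_self)
    show "e (d - i) (as (e (d - j) v)) \<noteq> 0" if "\<bar>int i - int j\<bar> = 1" "e (d - j) v \<noteq> 0"
      by (rule e_as_near) (simp_all only: eq that diff_le_self not_False_eq_True)
  qed (fact es_a_far es_a_near)+
qed

lemma es_a_neighbours:
  assumes "i \<le> d"
  shows "es i (a v) = (\<Sum>j\<in>{j. j \<le> d \<and> \<bar>int i - int j\<bar> \<le> 1}. es i (a (es j v)))"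
proof -
  have "es i (a v) = es i (a (\<Sum>j\<le>d. es j v))" by (simp add: S.e_sum)
  also have "\<dots> = (\<Sum>j\<le>d. es i (a (es j v)))"
    by (simp add: linear_sum[OF linear_a] linear_sum[OF S.linear_e])
  also have "\<dots> = (\<Sum>j\<in>{j. j \<le> d \<and> \<bar>int i - int j\<bar> \<le> 1}. es i (a (es j v)))"
    using assms by (intro sum.mono_neutral_right) (auto intro!: es_a_far)
  finally show ?thesis .
qed

lemma a_raises_support:
  assumes v: "\<And>j. \<lbrakk>n < j; j \<le> d\<rbrakk> \<Longrightarrow> es j v = 0" and i: "Suc n < i" "i \<le> d"
  shows "es i (a v) = 0"
proof (subst es_a_neighbours[OF i(2)], intro sum.neutral ballI)
  fix j assume "j \<in> {j. j \<le> d \<and> \<bar>int i - int j\<bar> \<le> 1}"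
  hence "es j v = 0" using i by (intro v) auto
  thus "es i (a (es j v)) = 0" by (simp add: a_simps S.e_simps)
qed

lemma es_a_top:
  assumes v: "\<And>j. \<lbrakk>n < j; j \<le> d\<rbrakk> \<Longrightarrow> es j v = 0" and n: "Suc n \<le> d"
  shows "es (Suc n) (a v) = es (Suc n) (a (es n v))"
proof -
  have "es (Suc n) (a v) = (\<Sum>j\<in>{j. j \<le> d \<and> \<bar>int (Suc n) - int j\<bar> \<le> 1}. if j = n then es (Suc n) (a (es j v)) else 0)"
  proof (subst es_a_neighbours[OF n], intro sum.cong refl)
    fix j assume j: "j \<in> {j. j \<le> d \<and> \<bar>int (Suc n) - int j\<bar> \<le> 1}"
    have "es j v = 0" if "j \<noteq> n" using j that by (intro v) auto
    thus "es (Suc n) (a (es j v)) = (if j = n then es (Suc n) (a (es j v)) else 0)"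
      by (auto simp: a_simps S.e_simps)
  qed
  also have "\<dots> = es (Suc n) (a (es n v))"
    using n by (subst sum.delta) auto
  finally show ?thesis .
qed

lemma funpow_support:
  assumes v: "\<And>j. \<lbrakk>n < j; j \<le> d\<rbrakk> \<Longrightarrow> es j v = 0" and "n + k < i" "i \<le> d"
  shows "es i ((a ^^ k) v) = 0"
  using assms(2-)
proof (induction k arbitrary: i)
  case (Suc k)
  have "es j ((a ^^ k) v) = 0" if "n + k < j" "j \<le> d" for j by (rule Suc.IH[OF that])
  thus ?case using a_raises_support[of "n + k" "(a ^^ k) v" i] Suc.prems by simp
qed (use v in auto)

text \<open>Each application of \<open>a\<close> moves the top component of a vector one starred line up, and it cannot
vanish there because the subdiagonal entries are nonzero. This is the source of all nonvanishing
statements.\<close>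

lemma funpow_top_nonzero:
  assumes v: "\<And>j. \<lbrakk>n < j; j \<le> d\<rbrakk> \<Longrightarrow> es j v = 0" and nz: "es n v \<noteq> 0" and "n + k \<le> d"
  shows "es (n + k) ((a ^^ k) v) \<noteq> 0"
  using assms(3)
proof (induction k)
  case (Suc k)
  have "es (n + Suc k) ((a ^^ Suc k) v) = es (Suc (n + k)) (a (es (n + k) ((a ^^ k) v)))"
    using Suc.prems by (simp, intro es_a_top funpow_support[OF v]) simp_all
  moreover have "es (n + k) ((a ^^ k) v) \<noteq> 0" using Suc by simp
  ultimately show ?case using es_a_near[of "Suc (n + k)" "n + k"] Suc.prems by simp
qed (use nz in simp)

lemma op_poly_support:
  assumes v: "\<And>j. \<lbrakk>n < j; j \<le> d\<rbrakk> \<Longrightarrow> es j v = 0" and "n + degree p < i" "i \<le> d"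
  shows "es i (op_poly scale p a v) = 0"
  unfolding op_poly_def linear_sum[OF S.linear_e]
proof (intro sum.neutral ballI)
  fix k assume "k \<in> {..degree p}"
  hence "es i ((a ^^ k) v) = 0" using assms(2,3) by (intro funpow_support[OF v]) auto
  thus "es i (coeff p k *s (a ^^ k) v) = 0" by (simp add: S.e_simps)
qed

lemma op_poly_top:
  assumes v: "\<And>j. \<lbrakk>n < j; j \<le> d\<rbrakk> \<Longrightarrow> es j v = 0" and "n + degree p \<le> d"
  shows "es (n + degree p) (op_poly scale p a v) = lead_coeff p *s es (n + degree p) ((a ^^ degree p) v)"
proof -
  have "es (n + degree p) (op_poly scale p a v)
      = (\<Sum>i\<le>degree p. if i = degree p then coeff p i *s es (n + degree p) ((a ^^ i) v) else 0)"
    unfolding op_poly_def linear_sum[OF S.linear_e]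
  proof (intro sum.cong refl)
    fix i assume i: "i \<in> {..degree p}"
    have "es (n + degree p) ((a ^^ i) v) = 0" if "i \<noteq> degree p"
      using i that assms(2) by (intro funpow_support[OF v]) auto
    thus "es (n + degree p) (coeff p i *s (a ^^ i) v)
      = (if i = degree p then coeff p i *s es (n + degree p) ((a ^^ i) v) else 0)"
      by (auto simp: S.e_simps)
  qed
  thus ?thesis by (simp add: sum.delta)
qed

lemma op_poly_top_nonzero:
  assumes v: "\<And>j. \<lbrakk>n < j; j \<le> d\<rbrakk> \<Longrightarrow> es j v = 0" and "es n v \<noteq> 0" "n + degree p \<le> d" "p \<noteq> 0"
  shows "es (n + degree p) (op_poly scale p a v) \<noteq> 0"
  using op_poly_top[OF v assms(3)] funpow_top_nonzero[OF v assms(2,3)] assms(4) by simp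

text \<open>If \<open>v\<close> has a top component on a starred line \<open>n < m\<close>, then the product of the linear factors
belonging to the remaining \<open>d + 1 - m\<close> eigenvalues kills \<open>v\<close>, although it moves the top component
to the line \<open>n + d + 1 - m \<le> d\<close>, where it does not vanish.\<close>

lemma zero_by_complementary_support:
  assumes "m \<le> Suc d" and es: "\<And>j. \<lbrakk>m \<le> j; j \<le> d\<rbrakk> \<Longrightarrow> es j v = 0"
    and e: "\<And>j. j < m \<Longrightarrow> e j v = 0"
  shows "v = 0"
proof (rule ccontr)
  assume "v \<noteq> 0"
  hence ex: "\<exists>n\<le>d. es n v \<noteq> 0" using S.e_sum[of v] by (metis atMost_iff sum.neutral)
  define n where "n = (GREATEST n. n \<le> d \<and> es n v \<noteq> 0)"
  have n: "n \<le> d" "es n v \<noteq> 0"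
    using GreatestI_ex_nat[of "\<lambda>n. n \<le> d \<and> es n v \<noteq> 0" d] ex unfolding n_def by auto
  have top: "es j v = 0" if "n < j" "j \<le> d" for j
    using Greatest_le_nat[of "\<lambda>n. n \<le> d \<and> es n v \<noteq> 0" j d] that unfolding n_def by fastforce
  have "n < m" using n es by (meson not_less)
  define p where "p = (\<Prod>j\<in>{m..d}. [:- \<theta> j, 1:])"
  have lead: "lead_coeff p = 1" unfolding p_def by (simp add: lead_coeff_prod)
  hence p0: "p \<noteq> 0" by auto
  have deg: "degree p = Suc d - m"
    unfolding p_def by (subst degree_prod_eq_sum_degree) auto
  have "op_poly scale p a v = 0"
  proof (rule e_expand_cong)
    fix i assume i: "i \<le> d"
    have "poly p (\<theta> i) = 0" if "m \<le> i" using that i by (auto simp: p_def poly_prod intro!: prod_zero)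
    thus "e i (op_poly scale p a v) = e i 0"
      using e[of i] i by (cases "i < m") (auto simp: e_op_poly e_simps)
  qed
  moreover have "es (n + degree p) (op_poly scale p a v) \<noteq> 0"
    by (rule op_poly_top_nonzero[OF top n(2) _ p0]) (use \<open>n < m\<close> assms(1) deg in auto)
  ultimately show False by (simp add: S.e_simps)
qed

lemma reverse_star: "tridiagonal_action scale d a e \<theta> as (\<lambda>i. es (d - i)) (\<lambda>i. \<theta>s (d - i))"
  by (rule tridiagonal_action.swap, rule tridiagonal_action.reverse, rule swap)

lemma as_lowers_support:
  assumes "\<And>j. j < m \<Longrightarrow> e j v = 0" and "m \<le> d" and "Suc i < m"
  shows "e i (as v) = 0"
proof -
  interpret R: tridiagonal_action scale d as "\<lambda>i. es i" "\<lambda>i. \<theta>s i" a "\<lambda>i. e (d - i)" "\<lambda>i. \<theta> (d - i)"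
    by (rule tridiagonal_action.swap, rule reverse)
  have "e (d - (d - i)) (as v) = 0"
    by (rule R.a_raises_support[of "d - m"]) (use assms in auto)
  thus ?thesis using assms by simp
qed

lemma star_line_support: "\<lbrakk>k \<le> d; es k \<xi> = \<xi>; j \<le> d; j \<noteq> k\<rbrakk> \<Longrightarrow> es j \<xi> = 0"
  using S.e_e[of j k \<xi>] by simp

text \<open>The polynomial \<open>tau \<theta> d\<close> is a multiple of the projection \<open>e d\<close>, and it has degree \<open>d\<close>, so it
carries the first starred line to a vector with nonzero component on the last one.\<close>

lemma first_to_last_nonzero:
  assumes "es 0 \<xi> = \<xi>" "\<xi> \<noteq> 0"
  shows "e d \<xi> \<noteq> 0"
proof
  assume "e d \<xi> = 0"
  hence "op_poly scale (tau \<theta> d) a \<xi> = 0" by (simp add: op_poly_tau_d)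
  moreover have "es (0 + degree (tau \<theta> d)) (op_poly scale (tau \<theta> d) a \<xi>) \<noteq> 0"
    using star_line_support[of 0 \<xi>] assms tau_monic[of \<theta> d]
    by (intro op_poly_top_nonzero) auto
  ultimately show False by (simp add: S.e_simps)
qed

lemma end_component_nonzero:
  assumes "es j \<xi> = \<xi>" "\<xi> \<noteq> 0" "j = 0 \<or> j = d" "i = 0 \<or> i = d"
  shows "e i \<xi> \<noteq> 0"
proof -
  interpret R: tridiagonal_action scale d a "\<lambda>i. e (d - i)" "\<lambda>i. \<theta> (d - i)" as es \<theta>s by (rule reverse)
  interpret RS: tridiagonal_action scale d a e \<theta> as "\<lambda>i. es (d - i)" "\<lambda>i. \<theta>s (d - i)" by (rule reverse_star)
  interpret RSR: tridiagonal_action scale d a "\<lambda>i. e (d - i)" "\<lambda>i. \<theta> (d - i)" as "\<lambda>i. es (d - i)" "\<lambda>i. \<theta>s (d - i)"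
    by (rule RS.reverse)
  show ?thesis
    using first_to_last_nonzero[of \<xi>] R.first_to_last_nonzero[of \<xi>]
      RS.first_to_last_nonzero[of \<xi>] RSR.first_to_last_nonzero[of \<xi>] assms by auto
qed

text \<open>The vectors \<open>\<tau>\<^sub>i(a) \<xi>\<close> are those of the split decomposition: the \<open>i\<close>-th spans the intersection of
the sum of the starred lines \<open>0, \<dots>, i\<close> with the sum of the lines \<open>i, \<dots>, d\<close>.\<close>

lemma split_vector_support:
  assumes "es 0 \<xi> = \<xi>" "\<xi> \<noteq> 0" "i \<le> d"
  shows "\<And>j. \<lbrakk>i < j; j \<le> d\<rbrakk> \<Longrightarrow> es j (op_poly scale (tau \<theta> i) a \<xi>) = 0"
    and "es i (op_poly scale (tau \<theta> i) a \<xi>) \<noteq> 0"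
    and "\<And>j. j < i \<Longrightarrow> e j (op_poly scale (tau \<theta> i) a \<xi>) = 0"
proof -
  have sup: "es j \<xi> = 0" if "0 < j" "j \<le> d" for j using star_line_support[of 0 \<xi> j] assms that by auto
  show "es j (op_poly scale (tau \<theta> i) a \<xi>) = 0" if "i < j" "j \<le> d" for j
    by (rule op_poly_support[OF sup]) (use that in \<open>auto simp: tau_monic\<close>)
  show "es i (op_poly scale (tau \<theta> i) a \<xi>) \<noteq> 0"
    using op_poly_top_nonzero[of 0 \<xi> "tau \<theta> i"] sup assms tau_monic[of \<theta> i] by fastforce
  show "e j (op_poly scale (tau \<theta> i) a \<xi>) = 0" if "j < i" for j
  proof -
    have "poly (tau \<theta> i) (\<theta> j) = 0" using that by (auto simp: poly_tau)
    thus ?thesis using that assms(3) by (simp add: e_op_poly)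
  qed
qed

text \<open>The left side lies in the sum of the starred lines up to \<open>i\<close>, since \<open>as\<close> is diagonal there and
\<open>\<theta>s (Suc i)\<close> is subtracted, and in the sum of the lines from \<open>i\<close> on, since \<open>as\<close> is tridiagonal.
Removing the right multiple of the \<open>i\<close>-th split vector leaves a vector of complementary support.\<close>

lemma split_recurrence:
  assumes \<xi>: "es 0 \<xi> = \<xi>" "\<xi> \<noteq> 0" and i: "Suc i \<le> d"
  shows "\<exists>c. as (op_poly scale (tau \<theta> (Suc i)) a \<xi>) - \<theta>s (Suc i) *s op_poly scale (tau \<theta> (Suc i)) a \<xi>
    = c *s op_poly scale (tau \<theta> i) a \<xi>"
proof -
  define u where "u k = op_poly scale (tau \<theta> k) a \<xi>" for k
  note sup = split_vector_support[OF \<xi>, folded u_def]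
  define v where "v = as (u (Suc i)) - \<theta>s (Suc i) *s u (Suc i)"
  obtain c where c: "es i v = c *s es i (u i)"
    using S.e_line[of i "u i" v] sup(2)[of i] i by auto
  have "v - c *s u i = 0"
  proof (rule zero_by_complementary_support[of i])
    show "es j (v - c *s u i) = 0" if "i \<le> j" "j \<le> d" for j
    proof (cases "j = i")
      case False
      hence "es j (u i) = 0" "es j v = 0"
        using that i sup(1)[of i j] sup(1)[of "Suc i" j]
        by (auto simp: v_def S.e_simps S.e_a) (metis Suc_leI le_neq_implies_less scale_zero_right diff_self)
      thus ?thesis by (simp add: S.e_simps)
    qed (use c in \<open>simp add: S.e_simps\<close>)
    show "e j (v - c *s u i) = 0" if "j < i" for j
      using that i sup(3)[of i j] sup(3)[of "Suc i"] as_lowers_support[of "Suc i" "u (Suc i)" j]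
      by (simp add: v_def e_simps)
  qed (use i in simp)
  thus ?thesis unfolding v_def u_def by auto
qed

text \<open>The projection of the split recurrence to the first starred line expresses its coefficient by the
numbers \<open>s i\<close>. They are the traces in the definition of the parameter array, so the coefficients
are the entries of that array. The recurrence also shows that \<open>s i = 0\<close> would force all later
\<open>s\<close> to vanish, while \<open>s d\<close> comes from the passage from the first starred line to the line \<open>d\<close> and
back, which is nonzero.\<close>

lemma split_coefficients:
  assumes \<xi>: "es 0 \<xi> = \<xi>" "\<xi> \<noteq> 0"
    and s: "\<And>i. i \<le> d \<Longrightarrow> es 0 (op_poly scale (tau \<theta> i) a \<xi>) = s i *s \<xi>"
  shows "i \<le> d \<Longrightarrow> s i \<noteq> 0"
    and "Suc i \<le> d \<Longrightarrow>
      as (op_poly scale (tau \<theta> (Suc i)) a \<xi>) - \<theta>s (Suc i) *s op_poly scale (tau \<theta> (Suc i)) a \<xi>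
      = ((\<theta>s 0 - \<theta>s (Suc i)) * (s (Suc i) / s i)) *s op_poly scale (tau \<theta> i) a \<xi>"
proof -
  define u where "u k = op_poly scale (tau \<theta> k) a \<xi>" for k
  obtain c where c: "as (u (Suc i)) - \<theta>s (Suc i) *s u (Suc i) = c i *s u i" if "Suc i \<le> d" for i
    using split_recurrence[OF \<xi>] unfolding u_def by metis
  have cs: "(\<theta>s 0 - \<theta>s (Suc i)) * s (Suc i) = c i * s i" if "Suc i \<le> d" for i
  proof -
    have "es 0 (as (u (Suc i)) - \<theta>s (Suc i) *s u (Suc i)) = es 0 (c i *s u i)"
      by (simp add: c that)
    hence "((\<theta>s 0 - \<theta>s (Suc i)) * s (Suc i)) *s \<xi> = (c i * s i) *s \<xi>"
      using that s[of i] s[of "Suc i"]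
      by (simp add: S.e_simps S.e_a u_def scale_left_diff_distrib left_diff_distrib)
    thus ?thesis using \<xi>(2) by simp
  qed
  interpret SW: tridiagonal_action scale d as es \<theta>s a e \<theta> by (rule swap)
  have "es 0 (e d \<xi>) \<noteq> 0"
    by (rule SW.end_component_nonzero[of d]) (use end_component_nonzero[OF \<xi>] e_e in auto)
  hence "es 0 (u d) \<noteq> 0"
    using tau_eigenvalue_nonzero by (simp add: u_def op_poly_tau_d S.e_simps)
  hence sd: "s d \<noteq> 0" using s[of d] by (auto simp: u_def)
  show nz: "s i \<noteq> 0" if "i \<le> d" for i
    using that
  proof (induction rule: inc_induct)
    case (step n)
    have "\<theta>s 0 \<noteq> \<theta>s (Suc n)" using inj_onD[OF S.inj_eigenvalues, of 0 "Suc n"] step by auto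
    thus ?case using cs[of n] step by auto
  qed (rule sd)
  show "as (op_poly scale (tau \<theta> (Suc i)) a \<xi>) - \<theta>s (Suc i) *s op_poly scale (tau \<theta> (Suc i)) a \<xi>
      = ((\<theta>s 0 - \<theta>s (Suc i)) * (s (Suc i) / s i)) *s op_poly scale (tau \<theta> i) a \<xi>" if "Suc i \<le> d"
    using c[OF that] cs[OF that] nz[of i] that unfolding u_def by (simp add: field_simps)
qed

text \<open>The quotients \<open>s i / s (i - 1)\<close> telescope, and the differences of starred eigenvalues make up the
value of the polynomial.\<close>

lemma prod_split_coefficients:
  assumes \<xi>: "es 0 \<xi> = \<xi>" "\<xi> \<noteq> 0"
    and s: "\<And>i. i \<le> d \<Longrightarrow> es 0 (op_poly scale (tau \<theta> i) a \<xi>) = s i *s \<xi>"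
    and f: "\<And>i. i \<in> {1..d} \<Longrightarrow> f i = (\<theta>s 0 - \<theta>s i) * (s i / s (i - 1))"
  shows "poly (eta d \<theta>s d) (\<theta>s 0) / (\<Prod>j=1..d. f j) = 1 / s d"
proof -
  have s0: "s 0 = 1" using s[of 0] \<xi> by (simp add: tau_0 op_poly_1) (metis scale_one scale_right_imp_eq)
  have prod: "(\<Prod>j=1..n. f j) = (\<Prod>j=1..n. \<theta>s 0 - \<theta>s j) * s n" if "n \<le> d" for n
    using that
  proof (induction n)
    case (Suc n)
    thus ?case using split_coefficients(1)[OF \<xi> s, of n] f[of "Suc n"] by simp
  qed (simp add: s0)
  have "poly (eta d \<theta>s d) (\<theta>s 0) = (\<Prod>j<d. \<theta>s 0 - \<theta>s (d - j))"
    by (simp add: eta_eq_tau poly_tau)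
  also have "\<dots> = (\<Prod>j=1..d. \<theta>s 0 - \<theta>s j)"
    by (rule prod.reindex_bij_witness[of _ "\<lambda>j. d - j" "\<lambda>j. d - j"]) auto
  finally have "poly (eta d \<theta>s d) (\<theta>s 0) = (\<Prod>j=1..d. \<theta>s 0 - \<theta>s j)" .
  moreover have "(\<Prod>j=1..d. \<theta>s 0 - \<theta>s j) \<noteq> 0"
    using inj_onD[OF S.inj_eigenvalues, of 0] by fastforce
  ultimately show ?thesis using prod[of d] by simp
qed

text \<open>For \<open>r < i\<close> the product of the two polynomials has every eigenvalue as a root. Otherwise it is monic
of degree \<open>d - (r - i)\<close>. The passage from the last starred line to the first takes \<open>d\<close> steps, so
a smaller degree gives zero, and in degree \<open>d\<close> only the leading coefficient matters.\<close>

lemma first_of_last_pairing: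
  assumes \<xi>: "es d \<xi> = \<xi>" and ir: "i \<le> d" "r \<le> d"
  shows "es 0 (op_poly scale (eta d \<theta> (d - r)) a (op_poly scale (tau \<theta> i) a \<xi>))
    = (if r = i then es 0 (op_poly scale (eta d \<theta> d) a \<xi>) else 0)"
proof -
  interpret RS: tridiagonal_action scale d a e \<theta> as "\<lambda>i. es (d - i)" "\<lambda>i. \<theta>s (d - i)" by (rule reverse_star)
  have sup: "es (d - j) \<xi> = 0" if "0 < j" "j \<le> d" for j
    using star_line_support[of d \<xi> "d - j"] \<xi> that by auto
  define p where "p = eta d \<theta> (d - r) * tau \<theta> i"
  have lead: "lead_coeff p = 1" by (simp only: p_def lead_coeff_mult eta_eq_tau tau_monic(2) mult_1)
  have deg: "degree p = d - r + i"
    unfolding p_def by (simp add: degree_mult_eq eta_eq_tau tau_monic(1) tau_nonzero)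
  have eq: "op_poly scale (eta d \<theta> (d - r)) a (op_poly scale (tau \<theta> i) a \<xi>) = op_poly scale p a \<xi>"
    by (simp add: p_def op_poly_mult)
  consider "r < i" | "i < r" | "i = r" by linarith
  thus ?thesis
  proof cases
    case 1
    have "op_poly scale p a \<xi> = 0"
    proof (rule e_expand_cong)
      fix k assume k: "k \<le> d"
      have "poly (tau \<theta> i) (\<theta> k) = 0" if "k < i" using that by (auto simp: poly_tau)
      moreover have "poly (eta d \<theta> (d - r)) (\<theta> k) = 0" if "i \<le> k"
        using that 1 k by (auto simp: eta_eq_tau poly_tau intro!: bexI[of _ "d - k"])
      ultimately have "poly p (\<theta> k) = 0" by (cases "k < i") (auto simp: p_def)
      thus "e k (op_poly scale p a \<xi>) = e k 0" using k by (simp add: e_op_poly e_simps)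
    qed
    thus ?thesis using 1 by (simp add: eq S.e_simps)
  next
    case 2
    hence "es (d - d) (op_poly scale p a \<xi>) = 0"
      by (intro RS.op_poly_support[OF sup]) (use deg ir in auto)
    thus ?thesis using 2 by (simp add: eq)
  next
    case 3
    have "es 0 (op_poly scale q a \<xi>) = es 0 ((a ^^ d) \<xi>)" if "lead_coeff q = 1" "degree q = d" for q
      using RS.op_poly_top[of 0 \<xi> q] sup that by simp
    moreover have "lead_coeff (eta d \<theta> d) = 1" "degree (eta d \<theta> d) = d"
      unfolding eta_eq_tau by (rule tau_monic)+
    moreover have "degree p = d" using deg 3 ir by simp
    ultimately show ?thesis using lead 3 unfolding eq by (simp only: simp_thms if_True)
  qed
qed

end

section \<open>Self-adjointness and the orthogonality relations\<close>

locale self_adjoint_tridiagonal_action = tridiagonal_action scale d a e \<theta> as es \<theta>s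
  for scale :: "'k::field \<Rightarrow> 'v::ab_group_add \<Rightarrow> 'v" (infixr \<open>*s\<close> 75)
    and d a e \<theta> as es \<theta>s +
  fixes B :: "'v \<Rightarrow> 'v \<Rightarrow> 'k"
  assumes B_linear_left: "Vector_Spaces.linear scale (*) (\<lambda>u. B u v)"
    and B_linear_right: "Vector_Spaces.linear scale (*) (B u)"
    and B_a: "B (a u) v = B u (a v)"
    and B_as: "B (as u) v = B u (as v)"
    and B_nondegenerate: "u \<noteq> 0 \<Longrightarrow> \<exists>v. B u v \<noteq> 0"
begin

lemmas B_simps = linear_scale[OF B_linear_left] linear_scale[OF B_linear_right]
  linear_zero[OF B_linear_left] linear_zero[OF B_linear_right]

lemma swap_self_adjoint: "self_adjoint_tridiagonal_action scale d as es \<theta>s a e \<theta> B"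
  by (intro self_adjoint_tridiagonal_action.intro swap self_adjoint_tridiagonal_action_axioms.intro
      B_linear_left B_linear_right B_a B_as B_nondegenerate)

lemma reverse_self_adjoint:
  "self_adjoint_tridiagonal_action scale d a (\<lambda>i. e (d - i)) (\<lambda>i. \<theta> (d - i)) as es \<theta>s B"
  by (intro self_adjoint_tridiagonal_action.intro reverse self_adjoint_tridiagonal_action_axioms.intro
      B_linear_left B_linear_right B_a B_as B_nondegenerate)

lemma B_e_orthogonal: "\<lbrakk>i \<le> d; j \<le> d; i \<noteq> j\<rbrakk> \<Longrightarrow> B (e i u) (e j v) = 0"
  using B_a[of "e i u" "e j v"] inj_onD[OF inj_eigenvalues, of i j] by (auto simp: a_e B_simps)

text \<open>Eigenlines of a self-adjoint operator are orthogonal, so its spectral projections are self-adjoint.\<close>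

lemma B_e:
  assumes "i \<le> d"
  shows "B (e i u) v = B u (e i v)"
proof -
  have "B (e i u) v = (\<Sum>j\<le>d. B (e i u) (e j v))"
    using linear_sum[OF B_linear_right, of "e i u" "\<lambda>j. e j v" "{..d}"] by (simp add: e_sum)
  also have "\<dots> = (\<Sum>j\<le>d. if j = i then B (e i u) (e j v) else 0)"
    using assms B_e_orthogonal by (intro sum.cong) auto
  also have "\<dots> = (\<Sum>j\<le>d. if j = i then B (e j u) (e i v) else 0)" by (intro sum.cong) auto
  also have "\<dots> = (\<Sum>j\<le>d. B (e j u) (e i v))"
    using assms B_e_orthogonal by (intro sum.cong) auto
  also have "\<dots> = B u (e i v)"
    using linear_sum[OF B_linear_left, of "\<lambda>j. e j u" "{..d}" "e i v"] by (simp add: e_sum)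
  finally show ?thesis .
qed

lemma B_op_poly: "B (op_poly scale p a u) v = B u (op_poly scale p a v)"
  using B_e by (simp add: op_poly_expand linear_sum[OF B_linear_left] linear_sum[OF B_linear_right] B_simps)

lemma e_projection:
  assumes "i \<le> d" "e i \<xi> = \<xi>" "\<xi> \<noteq> 0"
  shows "B \<xi> \<xi> \<noteq> 0" and "e i v = (B \<xi> v / B \<xi> \<xi>) *s \<xi>"
proof -
  have *: "\<exists>c. e i v = c *s \<xi> \<and> B \<xi> v = c * B \<xi> \<xi>" for v
    using e_on_line[OF assms(1,3,2), of v] B_e[OF assms(1), of \<xi> v] assms(2) by (auto simp: B_simps)
  show nz: "B \<xi> \<xi> \<noteq> 0" using B_nondegenerate[OF assms(3)] * by force
  show "e i v = (B \<xi> v / B \<xi> \<xi>) *s \<xi>" using *[of v] nz by auto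
qed

lemma B_nonzero: "\<lbrakk>i \<le> d; e i \<xi> = \<xi>; \<xi> \<noteq> 0; e i v \<noteq> 0\<rbrakk> \<Longrightarrow> B \<xi> v \<noteq> 0"
  using e_projection(2)[of i \<xi> v] by auto

text \<open>On the line \<open>d\<close> two vectors differ by the ratio of their products with \<open>\<xi>d\<close>, so the effect of
\<open>\<tau>\<^sub>d(a)\<close>, a multiple of \<open>e d\<close>, on any vector is known once it is known on \<open>\<xi>s0\<close>.\<close>

lemma corner:
  assumes \<xi>s0: "es 0 \<xi>s0 = \<xi>s0" "\<xi>s0 \<noteq> 0" and \<xi>d: "e d \<xi>d = \<xi>d" "\<xi>d \<noteq> 0"
    and s: "\<And>i. i \<le> d \<Longrightarrow> es 0 (op_poly scale (tau \<theta> i) a \<xi>s0) = s i *s \<xi>s0"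
  shows "es 0 (op_poly scale (tau \<theta> d) a v) = (s d * (B \<xi>d v / B \<xi>d \<xi>s0)) *s \<xi>s0"
proof -
  have nz: "B \<xi>d \<xi>d \<noteq> 0" "B \<xi>d \<xi>s0 \<noteq> 0"
    using e_projection(1)[of d \<xi>d] B_nonzero[of d \<xi>d \<xi>s0] end_component_nonzero[OF \<xi>s0] \<xi>d by auto
  have "e d v = (B \<xi>d v / B \<xi>d \<xi>s0) *s e d \<xi>s0"
    using e_projection(2)[of d \<xi>d] \<xi>d nz by simp
  hence "op_poly scale (tau \<theta> d) a v = (B \<xi>d v / B \<xi>d \<xi>s0) *s op_poly scale (tau \<theta> d) a \<xi>s0"
    by (simp add: op_poly_tau_d mult.commute)
  thus ?thesis using s[of d] by (simp add: S.e_simps mult.commute)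
qed

text \<open>The diagonal case of the pairing is the passage from \<open>\<xi>sd\<close> through the line \<open>0\<close> to the first
starred line. Compared with the same passage starting from \<open>\<xi>s0\<close>, which is the scalar \<open>s d\<close>, it
contributes the ratio of inner products, and the prefactor cancels both.\<close>

lemma transition_first_star:
  assumes \<xi>s0: "es 0 \<xi>s0 = \<xi>s0" "\<xi>s0 \<noteq> 0" and \<xi>sd: "es d \<xi>sd = \<xi>sd" "\<xi>sd \<noteq> 0"
    and \<xi>0: "e 0 \<xi>0 = \<xi>0" "\<xi>0 \<noteq> 0"
    and s: "\<And>i. i \<le> d \<Longrightarrow> es 0 (op_poly scale (eta d \<theta> i) a \<xi>s0) = s i *s \<xi>s0"
    and phi: "\<And>i. i \<in> {1..d} \<Longrightarrow> phi i = (\<theta>s 0 - \<theta>s i) * (s i / s (i - 1))"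
    and ir: "i \<le> d" "r \<le> d"
  shows "(poly (eta d \<theta>s d) (\<theta>s 0) / (\<Prod>j=1..d. phi j) * (B \<xi>0 \<xi>s0 / B \<xi>0 \<xi>sd)) *s
      es 0 (op_poly scale (eta d \<theta> (d - r)) a (op_poly scale (tau \<theta> i) a \<xi>sd))
    = (if r = i then \<xi>s0 else 0)"
proof -
  interpret R: self_adjoint_tridiagonal_action scale d a "\<lambda>i. e (d - i)" "\<lambda>i. \<theta> (d - i)" as es \<theta>s B
    by (rule reverse_self_adjoint)
  note s' = s[unfolded eta_eq_tau]
  have "s d \<noteq> 0" using R.split_coefficients(1)[OF \<xi>s0 s', of d] by simp
  moreover have "B \<xi>0 \<xi>s0 \<noteq> 0" "B \<xi>0 \<xi>sd \<noteq> 0"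
    using B_nonzero[of 0 \<xi>0] end_component_nonzero[OF \<xi>s0] end_component_nonzero[OF \<xi>sd] \<xi>0 by auto
  moreover have "poly (eta d \<theta>s d) (\<theta>s 0) / (\<Prod>j=1..d. phi j) = 1 / s d"
    by (rule R.prod_split_coefficients[OF \<xi>s0 s' phi])
  moreover have "es 0 (op_poly scale (eta d \<theta> d) a \<xi>sd) = (s d * (B \<xi>0 \<xi>sd / B \<xi>0 \<xi>s0)) *s \<xi>s0"
    unfolding eta_eq_tau by (rule R.corner[OF \<xi>s0 _ _ s']) (use \<xi>0 in auto)
  ultimately show ?thesis by (simp add: first_of_last_pairing[OF \<xi>sd(1) ir])
qed

text \<open>Since the diagonal value of the pairing depends on the leading coefficient only, the passage from
\<open>\<xi>sd\<close> to the first starred line may also be taken through the line \<open>d\<close>; here the numbers \<open>s\<close> are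
those of the natural ordering.\<close>

lemma transition_last:
  assumes \<xi>s0: "es 0 \<xi>s0 = \<xi>s0" "\<xi>s0 \<noteq> 0" and \<xi>sd: "es d \<xi>sd = \<xi>sd" "\<xi>sd \<noteq> 0"
    and \<xi>d: "e d \<xi>d = \<xi>d" "\<xi>d \<noteq> 0"
    and s: "\<And>i. i \<le> d \<Longrightarrow> es 0 (op_poly scale (tau \<theta> i) a \<xi>s0) = s i *s \<xi>s0"
    and varphi: "\<And>i. i \<in> {1..d} \<Longrightarrow> varphi i = (\<theta>s 0 - \<theta>s i) * (s i / s (i - 1))"
    and ir: "i \<le> d" "r \<le> d"
  shows "(poly (eta d \<theta>s d) (\<theta>s 0) / (\<Prod>j=1..d. varphi j) * (B \<xi>d \<xi>d / B \<xi>d \<xi>sd)) *s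
      e d (es 0 (op_poly scale (eta d \<theta> (d - r)) a (op_poly scale (tau \<theta> i) a \<xi>sd)))
    = (if r = i then \<xi>d else 0)"
proof -
  have "s d \<noteq> 0" using split_coefficients(1)[OF \<xi>s0 s, of d] by simp
  moreover have "B \<xi>d \<xi>s0 \<noteq> 0" "B \<xi>d \<xi>sd \<noteq> 0"
    using B_nonzero[of d \<xi>d] end_component_nonzero[OF \<xi>s0] end_component_nonzero[OF \<xi>sd] \<xi>d by auto
  moreover have "poly (eta d \<theta>s d) (\<theta>s 0) / (\<Prod>j=1..d. varphi j) = 1 / s d"
    by (rule prod_split_coefficients[OF \<xi>s0 s varphi])
  moreover have "es 0 (op_poly scale (eta d \<theta> d) a \<xi>sd) = (s d * (B \<xi>d \<xi>sd / B \<xi>d \<xi>s0)) *s \<xi>s0"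
    using first_of_last_pairing[OF \<xi>sd(1), of d d] corner[OF \<xi>s0 \<xi>d s, of \<xi>sd]
    by (simp add: eta_eq_tau tau_0 op_poly_1)
  moreover have "e d \<xi>s0 = (B \<xi>d \<xi>s0 / B \<xi>d \<xi>d) *s \<xi>d" "B \<xi>d \<xi>d \<noteq> 0"
    using e_projection[of d \<xi>d] \<xi>d by auto
  ultimately show ?thesis by (simp add: first_of_last_pairing[OF \<xi>sd(1) ir] e_simps)
qed

text \<open>Let \<open>u\<^sub>k = \<eta>\<^sub>k(a) \<xi>s0\<close>. The vector \<open>u\<^sub>d\<close> spans the line \<open>0\<close>, so the projection to this line is the
product with \<open>u\<^sub>d\<close>. The polynomial in \<open>as\<close> can be moved to \<open>u\<^sub>d\<close>, where the split recurrence turns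
it into \<open>\<phi>\<^sub>d \<dots> \<phi>\<^sub>d\<^sub>-\<^sub>r\<^sub>+\<^sub>1 u\<^sub>d\<^sub>-\<^sub>r\<close>. Moving \<open>\<eta>\<^sub>d\<^sub>-\<^sub>r(a)\<close> back leaves the pairing of the last starred line
with the first.\<close>

lemma transition_first:
  assumes \<xi>s0: "es 0 \<xi>s0 = \<xi>s0" "\<xi>s0 \<noteq> 0" and \<xi>sd: "es d \<xi>sd = \<xi>sd"
    and s: "\<And>i. i \<le> d \<Longrightarrow> es 0 (op_poly scale (eta d \<theta> i) a \<xi>s0) = s i *s \<xi>s0"
    and phi: "\<And>i. i \<in> {1..d} \<Longrightarrow> phi i = (\<theta>s 0 - \<theta>s i) * (s i / s (i - 1))"
    and ir: "i \<le> d" "r \<le> d"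
  shows "(1 / (\<Prod>j=d - r + 1..d. phi j)) *s e 0 (op_poly scale (eta d \<theta>s r) as (op_poly scale (tau \<theta> i) a \<xi>sd))
    = (if r = i then e 0 \<xi>sd else 0)"
proof -
  interpret R: self_adjoint_tridiagonal_action scale d a "\<lambda>i. e (d - i)" "\<lambda>i. \<theta> (d - i)" as es \<theta>s B
    by (rule reverse_self_adjoint)
  interpret SW: self_adjoint_tridiagonal_action scale d as es \<theta>s a e \<theta> B
    by (rule swap_self_adjoint)
  note s' = s[unfolded eta_eq_tau]
  define u where "u k = op_poly scale (eta d \<theta> k) a \<xi>s0" for k
  define P where "P r = (\<Prod>j=d - r + 1..d. phi j)" for r
  have phi_nz: "phi j \<noteq> 0" if "j \<in> {1..d}" for j
    using that phi[OF that] R.split_coefficients(1)[OF \<xi>s0 s', of j] R.split_coefficients(1)[OF \<xi>s0 s', of "j - 1"]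
      inj_onD[OF S.inj_eigenvalues, of 0 j] by (auto simp: le_diff_conv)
  \<comment> \<open>Each root of \<open>\<eta>\<^sup>*\<^sub>r\<close> is the starred eigenvalue at which the split recurrence moves one step down.\<close>
  have down: "op_poly scale (eta d \<theta>s r) as (u d) = P r *s u (d - r)" if "r \<le> d" for r
    using that
  proof (induction r)
    case (Suc r)
    have dr: "d - r = Suc (d - Suc r)" using Suc by simp
    have step: "as (u (d - r)) - \<theta>s (d - r) *s u (d - r) = phi (d - r) *s u (d - Suc r)"
      using R.split_coefficients(2)[OF \<xi>s0 s', of "d - Suc r"] phi[of "d - r"] Suc.prems
      unfolding dr u_def eta_eq_tau by simp
    have "op_poly scale (eta d \<theta>s (Suc r)) as (u d)
        = as (P r *s u (d - r)) - \<theta>s (d - r) *s (P r *s u (d - r))"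
      using Suc by (simp add: eta_eq_tau S.op_poly_tau_Suc)
    also have "\<dots> = P r *s (phi (d - r) *s u (d - Suc r))"
      unfolding step[symmetric] by (simp add: S.a_simps scale_right_diff_distrib mult.commute)
    also have "P r *s (phi (d - r) *s u (d - Suc r)) = P (Suc r) *s u (d - Suc r)"
    proof -
      have "{d - Suc r + 1..d} = insert (d - r) {d - r + 1..d}" using Suc.prems by auto
      thus ?thesis by (simp add: P_def mult.commute)
    qed
    finally show ?case .
  qed (simp add: P_def eta_eq_tau tau_0 S.op_poly_1)
  have ud: "e 0 (u d) = u d" "u d \<noteq> 0"
  proof -
    have "u d = (\<Prod>j<d. \<theta> 0 - \<theta> (d - j)) *s e 0 \<xi>s0"
      unfolding u_def eta_eq_tau by (simp add: R.op_poly_tau_d)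
    thus "e 0 (u d) = u d" "u d \<noteq> 0"
      using R.tau_eigenvalue_nonzero end_component_nonzero[OF \<xi>s0, of 0] by (auto simp: e_simps e_e)
  qed
  have "B (u d) (op_poly scale (eta d \<theta>s r) as (op_poly scale (tau \<theta> i) a \<xi>sd))
      = B (op_poly scale (eta d \<theta>s r) as (u d)) (op_poly scale (tau \<theta> i) a \<xi>sd)"
    by (rule SW.B_op_poly[symmetric])
  also have "\<dots> = P r * B (es 0 \<xi>s0) (op_poly scale (eta d \<theta> (d - r)) a (op_poly scale (tau \<theta> i) a \<xi>sd))"
    by (simp add: down[OF ir(2), unfolded u_def] B_simps u_def B_op_poly \<xi>s0)
  also have "\<dots> = P r * B \<xi>s0 (if r = i then es 0 (op_poly scale (eta d \<theta> d) a \<xi>sd) else 0)"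
    by (simp add: SW.B_e first_of_last_pairing[OF \<xi>sd ir])
  also have "\<dots> = P r * (if r = i then B (es 0 \<xi>s0) (op_poly scale (eta d \<theta> d) a \<xi>sd) else 0)"
    by (simp add: SW.B_e B_simps)
  also have "\<dots> = P r * (if r = i then B (u d) \<xi>sd else 0)"
    by (simp add: \<xi>s0 u_def B_op_poly)
  finally have "e 0 (op_poly scale (eta d \<theta>s r) as (op_poly scale (tau \<theta> i) a \<xi>sd))
      = P r *s (if r = i then e 0 \<xi>sd else 0)"
    using e_projection(2)[of 0 "u d"] ud by simp
  moreover have "P r \<noteq> 0" unfolding P_def using phi_nz by auto
  ultimately show ?thesis by (simp add: P_def)
qed

end

section \<open>Action of the algebra on an irreducible module\<close>

context irreducible_module
begin

lemma act_simps:
  "act (x + y) v = act x v + act y v" "act (scaleA c x) v = scaleV c (act x v)"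
  "act 0 v = 0" "act (sum f S) v = (\<Sum>i\<in>S. act (f i) v)"
  "act x (v + w) = act x v + act x w" "act x (scaleV c v) = scaleV c (act x v)" "act x 0 = 0"
proof -
  have l: "module_hom scaleA scaleV (\<lambda>x. act x v)"
    using act_linear_left by (rule Vector_Spaces.linear.axioms(3))
  have r: "module_hom scaleV scaleV (act x)"
    using act_linear_right by (rule Vector_Spaces.linear.axioms(3))
  show "act (x + y) v = act x v + act y v" "act (scaleA c x) v = scaleV c (act x v)"
    "act 0 v = 0" "act (sum f S) v = (\<Sum>i\<in>S. act (f i) v)"
    by (fact module_hom.add[OF l] module_hom.scale[OF l] module_hom.zero[OF l] module_hom.sum[OF l])+
  show "act x (v + w) = act x v + act x w" "act x (scaleV c v) = scaleV c (act x v)" "act x 0 = 0"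
    by (fact module_hom.add[OF r] module_hom.scale[OF r] module_hom.zero[OF r])+
qed

lemma act_power: "act (x ^ n) v = (act x ^^ n) v"
  by (induction n) (simp_all add: act_one act_mult)

lemma act_alg_poly: "act (alg_poly scaleA p x) v = op_poly scaleV p (act x) v"
  by (simp add: alg_poly_def op_poly_def act_simps act_power)

text \<open>This takes the place of the dimension of the module: together with the rank-one identities it makes
the eigenspaces lines, and together with invariance it makes the form nondegenerate.\<close>

lemma act_cyclic:
  assumes "v \<noteq> 0"
  shows "\<exists>x. w = act x v"
proof -
  have "V.subspace (range (\<lambda>x. act x v))"
  proof (rule V.subspaceI)
    show "0 \<in> range (\<lambda>x. act x v)" by (rule range_eqI[of _ _ 0]) (simp add: act_simps)
  next
    fix p q assume "p \<in> range (\<lambda>x. act x v)" "q \<in> range (\<lambda>x. act x v)"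
    then obtain x y where "p = act x v" "q = act y v" by auto
    thus "p + q \<in> range (\<lambda>x. act x v)" by (intro range_eqI[of _ _ "x + y"]) (simp add: act_simps)
  next
    fix c p assume "p \<in> range (\<lambda>x. act x v)"
    then obtain x where "p = act x v" by auto
    thus "scaleV c p \<in> range (\<lambda>x. act x v)"
      by (intro range_eqI[of _ _ "scaleA c x"]) (simp add: act_simps)
  qed
  moreover have "act x p \<in> range (\<lambda>x. act x v)" if p: "p \<in> range (\<lambda>x. act x v)" for x p
  proof -
    obtain y where "p = act y v" using p by auto
    thus ?thesis by (intro range_eqI[of _ _ "x * y"]) (simp add: act_mult)
  qed
  ultimately have "range (\<lambda>x. act x v) = {0} \<or> range (\<lambda>x. act x v) = UNIV" by (rule irreducible)
  moreover have "v \<in> range (\<lambda>x. act x v)" by (rule range_eqI[of _ _ 1]) (simp add: act_one)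
  ultimately have "range (\<lambda>x. act x v) = UNIV" using assms by auto
  thus ?thesis by (auto simp: image_iff set_eq_iff)
qed

lemma act_simple_spectrum:
  assumes "idempotents_with_eigenvalues scaleA d rep A E \<theta>"
  shows "simple_spectrum scaleV d (act A) (\<lambda>i. act (E i)) \<theta>"
proof (intro simple_spectrum.intro V.vector_space_axioms simple_spectrum_axioms.intro act_linear_right)
  fix i assume i: "i \<le> d"
  show "act (E i) (act (E j) v) = (if i = j then act (E j) v else 0)" if "j \<le> d" for j v
    using primitive_idempotent_mult[OF assms i that] by (auto simp: act_mult[symmetric] act_simps)
  show "act A (act (E i) v) = scaleV (\<theta> i) (act (E i) v)" for v
    using primitive_idempotent_eigen[OF assms i i] by (simp add: act_mult[symmetric] act_simps)
  fix v w assume "act (E i) v \<noteq> 0"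
  then obtain x where "w = act x (act (E i) v)" using act_cyclic by blast
  hence "act (E i) w = act (E i * x * E i) v" by (simp add: act_mult)
  thus "\<exists>c. act (E i) w = scaleV c (act (E i) v)" using primitive_idempotent_trace[OF assms i i] by (auto simp: act_simps)
next
  show "(\<Sum>i\<le>d. act (E i) v) = v" for v
    using primitive_idempotent_sum[OF assms, of 0 0]
    by (simp add: act_simps[symmetric] act_one)
  show "inj_on \<theta> {..d}" using assms by (simp add: idempotents_with_eigenvalues_def bij_betw_def)
qed

lemma act_primitive_idempotent_fixes:
  assumes "idempotents_with_eigenvalues scaleA d rep A E \<theta>" "i \<le> d" "\<xi> \<in> range (act (E i))"
  shows "act (E i) \<xi> = \<xi>"
  using assms(3) primitive_idempotent_mult[OF assms(1,2,2)] by (auto simp: act_mult[symmetric])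

lemma act_corner:
  assumes "idempotents_with_eigenvalues scaleA d rep A E \<theta>" "i \<le> d" "act (E i) \<xi> = \<xi>"
  shows "act (E i) (act x \<xi>) = scaleV (alg_trace rep (x * E i)) \<xi>"
proof -
  have "act (E i) (act x \<xi>) = act (E i * x * E i) \<xi>" by (simp add: act_mult assms(3))
  thus ?thesis using primitive_idempotent_trace[OF assms(1,2,2)] by (simp add: act_simps assms(3))
qed

lemma act_tridiagonal:
  assumes L: "leonard_system scaleA d rep A E As Es"
    and E: "idempotents_with_eigenvalues scaleA d rep A E \<theta>"
    and Es: "idempotents_with_eigenvalues scaleA d rep As Es \<theta>s"
  shows "tridiagonal_action scaleV d (act A) (\<lambda>i. act (E i)) \<theta> (act As) (\<lambda>i. act (Es i)) \<theta>s"
proof (intro tridiagonal_action.intro act_simple_spectrum[OF E] act_simple_spectrum[OF Es]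
    tridiagonal_action_axioms.intro)
  fix i j v assume ij: "i \<le> d" "j \<le> d"
  have near: "act (F i) (act x (act (F j) v)) \<noteq> 0"
    if F: "idempotents_with_eigenvalues scaleA d rep y F \<mu>" and nz: "F i * x * F j \<noteq> 0"
      and v: "act (F j) v \<noteq> 0" for F x y \<mu>
  proof
    assume 0: "act (F i) (act x (act (F j) v)) = 0"
    obtain z where "F j * z * (F i * x * F j) = F j"
      using primitive_idempotent_return[OF F ij nz] by blast
    hence "act (F j) v = act (F j * z) (act (F i) (act x (act (F j) v)))"
      by (metis act_mult)
    thus False using v 0 by (simp add: act_simps)
  qed
  show "act (Es i) (act A (act (Es j) v)) = 0" if "1 < \<bar>int i - int j\<bar>"
    using L ij that by (simp add: leonard_system_def act_mult[symmetric] act_simps mult.assoc)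
  show "act (E i) (act As (act (E j) v)) = 0" if "1 < \<bar>int i - int j\<bar>"
    using L ij that by (simp add: leonard_system_def act_mult[symmetric] act_simps mult.assoc)
  show "act (Es i) (act A (act (Es j) v)) \<noteq> 0" if "\<bar>int i - int j\<bar> = 1" "act (Es j) v \<noteq> 0"
    using L ij that near[OF Es] by (simp add: leonard_system_def)
  show "act (E i) (act As (act (E j) v)) \<noteq> 0" if "\<bar>int i - int j\<bar> = 1" "act (E j) v \<noteq> 0"
    using L ij that near[OF E] by (simp add: leonard_system_def)
qed

lemma invariant_form_nondegenerate:
  assumes B: "bilinear_form scaleV B" "\<exists>u v. B u v \<noteq> 0"
    and inv: "\<forall>x u v. B (act x u) v = B u (act (dag x) v)" and "u \<noteq> 0"
  shows "\<exists>v. B u v \<noteq> 0"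
proof (rule ccontr)
  assume 0: "\<not> (\<exists>v. B u v \<noteq> 0)"
  obtain u' v' where nz: "B u' v' \<noteq> 0" using B(2) by blast
  obtain x where "u' = act x u" using act_cyclic[OF assms(4)] by blast
  thus False using nz 0 inv by simp
qed

lemma sum_collapse:
  assumes i: "i \<le> d"
    and Y: "\<And>r. r \<le> d \<Longrightarrow> scaleV c (act (Y r) w) = (if r = i then \<xi> else 0)"
  shows "act (scaleA c (\<Sum>r\<le>d. X r * Y r)) w = act (X i) \<xi>"
proof -
  have "act (scaleA c (\<Sum>r\<le>d. X r * Y r)) w = (\<Sum>r\<le>d. act (X r) (scaleV c (act (Y r) w)))"
    by (simp add: act_simps act_mult V.scale_sum_right)
  also have "\<dots> = (\<Sum>r\<le>d. if r = i then act (X r) \<xi> else 0)"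
    by (intro sum.cong) (auto simp: Y act_simps)
  also have "\<dots> = act (X i) \<xi>" using i by simp
  finally show ?thesis .
qed

text \<open>The sequence \<open>X\<close> is arbitrary: the eight formulas only use that the operators next to \<open>X r\<close> send
the split vectors of \<open>\<xi>sd\<close> to a Kronecker delta. The second formula is the first one for the
reversed sequence at the reversed index.\<close>

lemma sum_collapse_both:
  assumes i: "i \<le> d"
    and Y: "\<And>i r. \<lbrakk>i \<le> d; r \<le> d\<rbrakk> \<Longrightarrow> scaleV c (act (Y r) (w i)) = (if r = i then \<xi> else 0)"
  shows "act (scaleA c (\<Sum>r\<le>d. X r * Y r)) (w i) = act (X i) \<xi>"
    and "act (scaleA c (\<Sum>r\<le>d. X (d - r) * Y r)) (w (d - i)) = act (X i) \<xi>"
  using sum_collapse[OF i Y] sum_collapse[of "d - i" c Y "w (d - i)" \<xi> "\<lambda>r. X (d - r)"] i Y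
  by simp_all

end

theorem theorem16p1:
  fixes scaleA :: "'k::field \<Rightarrow> 'a::ring_1 \<Rightarrow> 'a" and d :: nat and rep :: "'a \<Rightarrow> 'k mat"
    and scaleV :: "'k \<Rightarrow> 'v::ab_group_add \<Rightarrow> 'v" and act :: "'a \<Rightarrow> 'v \<Rightarrow> 'v"
    and A As :: 'a and E Es :: "nat \<Rightarrow> 'a"
    and \<theta> \<theta>s varphi phi :: "nat \<Rightarrow> 'k"
    and dag :: "'a \<Rightarrow> 'a" and B :: "'v \<Rightarrow> 'v \<Rightarrow> 'k"
    and \<xi>0 \<xi>d \<xi>s0 \<xi>sd :: 'v
  assumes "irreducible_module scaleA d rep scaleV act"
    and "leonard_system scaleA d rep A E As Es"
    and "parameter_array scaleA d rep A E As Es \<theta> \<theta>s varphi phi"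
    and "antiautomorphism scaleA dag" and "dag A = A" and "dag As = As"
    and "bilinear_form scaleV B" and "\<exists>u v. B u v \<noteq> 0"
    and "\<forall>X u v. B (act X u) v = B u (act (dag X) v)"
    and "\<xi>0 \<in> range (act (E 0))" and "\<xi>0 \<noteq> 0"
    and "\<xi>d \<in> range (act (E d))" and "\<xi>d \<noteq> 0"
    and "\<xi>s0 \<in> range (act (Es 0))" and "\<xi>s0 \<noteq> 0"
    and "\<xi>sd \<in> range (act (Es d))" and "\<xi>sd \<noteq> 0"
  shows
    "(\<forall>X \<in> {E, \<lambda>i. E (d - i),
        \<lambda>i. alg_poly scaleA (tau \<theta> i) A, \<lambda>i. alg_poly scaleA (tau \<theta> (d - i)) A,
        \<lambda>i. alg_poly scaleA (eta d \<theta> i) A, \<lambda>i. alg_poly scaleA (eta d \<theta> (d - i)) A}.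
      \<forall>i\<le>d.
        act (scaleA (poly (eta d \<theta>s d) (\<theta>s 0) / (\<Prod>j=1..d. phi j) * (B \<xi>0 \<xi>s0 / B \<xi>0 \<xi>sd))
            (\<Sum>r\<le>d. X r * Es 0 * alg_poly scaleA (eta d \<theta> (d - r)) A))
          (act (alg_poly scaleA (tau \<theta> i) A) \<xi>sd) = act (X i) \<xi>s0 \<and>
        act (scaleA (1 / alg_trace rep (E 0 * Es d))
            (\<Sum>r\<le>d. scaleA (1 / (\<Prod>j=d - r + 1..d. phi j)) (X r * Es d * E 0 * alg_poly scaleA (eta d \<theta>s r) As)))
          (act (alg_poly scaleA (tau \<theta> i) A) \<xi>sd) = act (X i) \<xi>sd \<and>
        act (scaleA (poly (eta d \<theta>s d) (\<theta>s 0) / (\<Prod>j=1..d. phi j) * (B \<xi>0 \<xi>s0 / B \<xi>0 \<xi>sd))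
            (\<Sum>r\<le>d. X (d - r) * Es 0 * alg_poly scaleA (eta d \<theta> (d - r)) A))
          (act (alg_poly scaleA (tau \<theta> (d - i)) A) \<xi>sd) = act (X i) \<xi>s0 \<and>
        act (scaleA (1 / alg_trace rep (E 0 * Es d))
            (\<Sum>r\<le>d. scaleA (1 / (\<Prod>j=d - r + 1..d. phi j)) (X (d - r) * Es d * E 0 * alg_poly scaleA (eta d \<theta>s r) As)))
          (act (alg_poly scaleA (tau \<theta> (d - i)) A) \<xi>sd) = act (X i) \<xi>sd) \<and>
    (\<forall>X \<in> {Es, \<lambda>i. Es (d - i),
        \<lambda>i. alg_poly scaleA (tau \<theta>s i) As, \<lambda>i. alg_poly scaleA (tau \<theta>s (d - i)) As,
        \<lambda>i. alg_poly scaleA (eta d \<theta>s i) As, \<lambda>i. alg_poly scaleA (eta d \<theta>s (d - i)) As}.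
      \<forall>i\<le>d.
        act (scaleA (B \<xi>0 \<xi>0 / B \<xi>0 \<xi>sd)
            (\<Sum>r\<le>d. scaleA (1 / (\<Prod>j=d - r + 1..d. phi j)) (X r * E 0 * alg_poly scaleA (eta d \<theta>s r) As)))
          (act (alg_poly scaleA (tau \<theta> i) A) \<xi>sd) = act (X i) \<xi>0 \<and>
        act (scaleA (poly (eta d \<theta>s d) (\<theta>s 0) / (\<Prod>j=1..d. varphi j) * (B \<xi>d \<xi>d / B \<xi>d \<xi>sd))
            (\<Sum>r\<le>d. X r * E d * Es 0 * alg_poly scaleA (eta d \<theta> (d - r)) A))
          (act (alg_poly scaleA (tau \<theta> i) A) \<xi>sd) = act (X i) \<xi>d \<and>
        act (scaleA (B \<xi>0 \<xi>0 / B \<xi>0 \<xi>sd)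
            (\<Sum>r\<le>d. scaleA (1 / (\<Prod>j=d - r + 1..d. phi j)) (X (d - r) * E 0 * alg_poly scaleA (eta d \<theta>s r) As)))
          (act (alg_poly scaleA (tau \<theta> (d - i)) A) \<xi>sd) = act (X i) \<xi>0 \<and>
        act (scaleA (poly (eta d \<theta>s d) (\<theta>s 0) / (\<Prod>j=1..d. varphi j) * (B \<xi>d \<xi>d / B \<xi>d \<xi>sd))
            (\<Sum>r\<le>d. X (d - r) * E d * Es 0 * alg_poly scaleA (eta d \<theta> (d - r)) A))
          (act (alg_poly scaleA (tau \<theta> (d - i)) A) \<xi>sd) = act (X i) \<xi>d)"
proof -
  interpret irreducible_module scaleA d rep scaleV act by fact
  note L = assms(2) and PA = assms(3)[unfolded parameter_array_def]
  have IE: "idempotents_with_eigenvalues scaleA d rep A E \<theta>"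
    and IEs: "idempotents_with_eigenvalues scaleA d rep As Es \<theta>s"
    and varphi: "\<And>i. i \<in> {1..d} \<Longrightarrow> varphi i = (\<theta>s 0 - \<theta>s i) *
        (alg_trace rep (alg_poly scaleA (tau \<theta> i) A * Es 0) /
         alg_trace rep (alg_poly scaleA (tau \<theta> (i - 1)) A * Es 0))"
    and phi: "\<And>i. i \<in> {1..d} \<Longrightarrow> phi i = (\<theta>s 0 - \<theta>s i) *
        (alg_trace rep (alg_poly scaleA (eta d \<theta> i) A * Es 0) /
         alg_trace rep (alg_poly scaleA (eta d \<theta> (i - 1)) A * Es 0))"
    using PA by blast+
  interpret T: self_adjoint_tridiagonal_action scaleV d "act A" "\<lambda>i. act (E i)" \<theta>
      "act As" "\<lambda>i. act (Es i)" \<theta>s B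
  proof (intro self_adjoint_tridiagonal_action.intro act_tridiagonal[OF L IE IEs]
      self_adjoint_tridiagonal_action_axioms.intro)
    show "\<exists>v. B u v \<noteq> 0" if "u \<noteq> 0" for u
      by (rule invariant_form_nondegenerate[OF assms(7-9) that])
    show "B (act A u) v = B u (act A v)" "B (act As u) v = B u (act As v)" for u v
      using assms(9)[rule_format, of A u v] assms(9)[rule_format, of As u v] assms(5,6) by simp_all
  qed (use assms(7) in \<open>simp_all add: bilinear_form_def\<close>)
  have e0: "act (E 0) \<xi>0 = \<xi>0" and ed: "act (E d) \<xi>d = \<xi>d"
    and es0: "act (Es 0) \<xi>s0 = \<xi>s0" and esd: "act (Es d) \<xi>sd = \<xi>sd"
    by (rule act_primitive_idempotent_fixes[OF IE] act_primitive_idempotent_fixes[OF IEs];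
        use assms(10,12,14,16) in simp)+
  note nz = assms(11,13,15,17)
  have s: "act (Es 0) (op_poly scaleV p (act A) \<xi>s0)
      = scaleV (alg_trace rep (alg_poly scaleA p A * Es 0)) \<xi>s0" for p
    unfolding act_alg_poly[symmetric] by (rule act_corner[OF IEs _ es0]) simp
  define ps where "ps r = (\<Prod>j=d - r + 1..d. phi j)" for r
  have proj: "act (E 0) \<xi>sd = scaleV (B \<xi>0 \<xi>sd / B \<xi>0 \<xi>0) \<xi>0" "B \<xi>0 \<xi>0 \<noteq> 0" "B \<xi>0 \<xi>sd \<noteq> 0"
    by (rule T.e_projection[OF _ e0 nz(1)] T.B_nonzero[OF _ e0 nz(1)]; simp
        add: T.end_component_nonzero[OF esd nz(4)])+
  have tr: "act (Es d) (act (E 0) \<xi>sd) = scaleV (alg_trace rep (E 0 * Es d)) \<xi>sd"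
    by (rule act_corner[OF IEs _ esd]) simp
  interpret SW: tridiagonal_action scaleV d "act As" "\<lambda>i. act (Es i)" \<theta>s "act A" "\<lambda>i. act (E i)" \<theta>
    by (rule T.swap)
  have "act (Es d) (act (E 0) \<xi>sd) \<noteq> 0"
  proof (rule SW.end_component_nonzero)
    show "act (E 0) (act (E 0) \<xi>sd) = act (E 0) \<xi>sd" using T.e_e[of 0 0 \<xi>sd] by simp
    show "act (E 0) \<xi>sd \<noteq> 0" by (rule T.end_component_nonzero[OF esd nz(4)]) simp_all
  qed simp_all
  hence tr0: "alg_trace rep (E 0 * Es d) \<noteq> 0" unfolding tr by auto
  have D1: "scaleV (poly (eta d \<theta>s d) (\<theta>s 0) / (\<Prod>j=1..d. phi j) * (B \<xi>0 \<xi>s0 / B \<xi>0 \<xi>sd))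
      (act (Es 0 * alg_poly scaleA (eta d \<theta> (d - r)) A) (act (alg_poly scaleA (tau \<theta> i) A) \<xi>sd))
      = (if r = i then \<xi>s0 else 0)" if "i \<le> d" "r \<le> d" for i r
    unfolding act_mult act_alg_poly
    by (rule T.transition_first_star[OF es0 nz(3) esd nz(4) e0 nz(1) s phi that])
  have D4: "scaleV (poly (eta d \<theta>s d) (\<theta>s 0) / (\<Prod>j=1..d. varphi j) * (B \<xi>d \<xi>d / B \<xi>d \<xi>sd))
      (act (E d * Es 0 * alg_poly scaleA (eta d \<theta> (d - r)) A) (act (alg_poly scaleA (tau \<theta> i) A) \<xi>sd))
      = (if r = i then \<xi>d else 0)" if "i \<le> d" "r \<le> d" for i r
    unfolding act_mult act_alg_poly
    by (rule T.transition_last[OF es0 nz(3) esd nz(4) ed nz(2) s varphi that])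
  have D: "scaleV (1 / ps r) (act (E 0) (op_poly scaleV (eta d \<theta>s r) (act As)
      (op_poly scaleV (tau \<theta> i) (act A) \<xi>sd))) = (if r = i then act (E 0) \<xi>sd else 0)"
    if "i \<le> d" "r \<le> d" for i r
    unfolding ps_def by (rule T.transition_first[OF es0 nz(3) esd s phi that])
  have D2: "scaleV (1 / alg_trace rep (E 0 * Es d)) (act (scaleA (1 / ps r)
      (Es d * E 0 * alg_poly scaleA (eta d \<theta>s r) As)) (act (alg_poly scaleA (tau \<theta> i) A) \<xi>sd))
      = (if r = i then \<xi>sd else 0)" if "i \<le> d" "r \<le> d" for i r
  proof -
    have "act (scaleA (1 / ps r) (Es d * E 0 * alg_poly scaleA (eta d \<theta>s r) As))
        (act (alg_poly scaleA (tau \<theta> i) A) \<xi>sd)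
      = act (Es d) (if r = i then act (E 0) \<xi>sd else 0)"
      unfolding D[OF that, symmetric] by (simp add: act_simps act_mult act_alg_poly)
    thus ?thesis using tr0 by (simp add: tr act_simps)
  qed
  have D3: "scaleV (B \<xi>0 \<xi>0 / B \<xi>0 \<xi>sd) (act (scaleA (1 / ps r)
      (E 0 * alg_poly scaleA (eta d \<theta>s r) As)) (act (alg_poly scaleA (tau \<theta> i) A) \<xi>sd))
      = (if r = i then \<xi>0 else 0)" if "i \<le> d" "r \<le> d" for i r
  proof -
    have "act (scaleA (1 / ps r) (E 0 * alg_poly scaleA (eta d \<theta>s r) As))
        (act (alg_poly scaleA (tau \<theta> i) A) \<xi>sd) = (if r = i then act (E 0) \<xi>sd else 0)"
      unfolding D[OF that, symmetric] by (simp add: act_simps act_mult act_alg_poly)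
    thus ?thesis using proj by simp
  qed
  note collapse = sum_collapse_both[where w = "\<lambda>i. act (alg_poly scaleA (tau \<theta> i) A) \<xi>sd"]
  note C1 = collapse[OF _ D1, unfolded mult.assoc scaleA_mult_right]
    and C2 = collapse[OF _ D2, unfolded mult.assoc scaleA_mult_right]
    and C3 = collapse[OF _ D3, unfolded mult.assoc scaleA_mult_right]
    and C4 = collapse[OF _ D4, unfolded mult.assoc scaleA_mult_right]
  show ?thesis
    unfolding ps_def[symmetric] mult.assoc scaleA_mult_right
    by (intro conjI ballI allI impI) (rule C1 C2 C3 C4; assumption)+
qed

end
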